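(* Suppose that $(X,d)$ is a finite metric space, and $Y$ is an infinite-dimensional Banach space. Then there exists $\alpha' \in (0,1)$ such that whenever $0 < \alpha < \alpha'$, the metric space $(X,d^\alpha)$ embeds isometrically into $Y$.
   Context: For $\alpha \in (0,1)$, $(X,d^\alpha)$ denotes the $\alpha$-snowflake of $(X,d)$, i.e. the set $X$ with the metric $(x,y) \mapsto d(x,y)^\alpha$. Isometric embeddings are distance-preserving maps. *)

theory Defs
  imports "HOL-Analysis.Analysis"
begin

text \<open>
  For \<open>0 < \<alpha> < 1\<close> this is the metric of the snowflake; as \<open>0 powr \<alpha> = 0\<close>, it vanishes on the
  diagonal.
\<close>

definition snowflake :: "real \<Rightarrow> ('a \<Rightarrow> 'a \<Rightarrow> real) \<Rightarrow> 'a \<Rightarrow> 'a \<Rightarrow> real"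
  where "snowflake \<alpha> d = (\<lambda>x y. d x y powr \<alpha>)"

lemma powr_add_le_add_powr:
  fixes a b p :: real
  assumes "0 \<le> a" "0 \<le> b" "0 < p" "p < 1"
  shows "(a + b) powr p \<le> a powr p + b powr p"
proof (cases "a + b = 0")
  case False
  then have s: "a + b > 0" using assms by linarith
  have *: "t \<le> t powr p" if "0 \<le> t" "t \<le> 1" for t :: real
    using powr_mono'[of p 1 t] that assms by simp
  have "1 = a / (a + b) + b / (a + b)"
    using s by (simp add: add_divide_distrib[symmetric])
  also have "\<dots> \<le> (a / (a + b)) powr p + (b / (a + b)) powr p"
    by (intro add_mono *) (use s assms in auto)
  also have "\<dots> = (a powr p + b powr p) / (a + b) powr p"
    using s assms by (simp add: powr_divide add_divide_distrib)
  finally show ?thesis using s by (simp add: pos_le_divide_eq)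
qed (use assms in auto)

lemma Metric_space_snowflake:
  assumes "Metric_space X d" "0 < \<alpha>" "\<alpha> < 1"
  shows "Metric_space X (snowflake \<alpha> d)"
proof -
  interpret Metric_space X d by fact
  show ?thesis
  proof
    fix x y z assume "x \<in> X" "y \<in> X" "z \<in> X"
    then have "d x z powr \<alpha> \<le> (d x y + d y z) powr \<alpha>"
      by (intro powr_mono2) (use assms triangle in auto)
    also have "\<dots> \<le> d x y powr \<alpha> + d y z powr \<alpha>"
      using assms by (intro powr_add_le_add_powr) auto
    finally show "snowflake \<alpha> d x z \<le> snowflake \<alpha> d x y + snowflake \<alpha> d y z"
      by (simp add: snowflake_def)
  qed (auto simp: snowflake_def commute)
qed

text \<open>
  Distance-preserving maps of a carrier set, with an explicit metric, into a metric space given by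
  type class; they are not required to be onto.
\<close>

definition isometric_embedding ::
    "'a set \<Rightarrow> ('a \<Rightarrow> 'a \<Rightarrow> real) \<Rightarrow> ('a \<Rightarrow> 'b::metric_space) \<Rightarrow> bool"
  where "isometric_embedding X d f \<longleftrightarrow> (\<forall>x\<in>X. \<forall>y\<in>X. dist (f x) (f y) = d x y)"

text \<open>No finite set spans the space (algebraic span over the reals).\<close>

definition infinite_dimensional :: "'b::real_vector itself \<Rightarrow> bool"
  where "infinite_dimensional _ \<longleftrightarrow> \<not> (\<exists>B::'b set. finite B \<and> span B = UNIV)"

end

theory Submission
  imports Defs
begin

text \<open>
  As \<open>\<alpha>\<close> tends to \<open>0\<close>, all distances of the snowflake tend to \<open>1\<close>, so it suffices that every
  metric on \<open>X\<close> whose distances lie in some fixed interval \<open>[r1, r2]\<close> with \<open>0 < r1 < r2\<close> embeds. For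
  each pair of points take one real parameter, and move the points of a finite configuration
  continuously with the parameters. If the distance of each pair is at most \<open>r1\<close> when its own
  parameter is \<open>0\<close> and at least \<open>r2\<close> when it is \<open>1\<close>, whatever the other parameters are, then the
  Poincare-Miranda theorem yields all metrics with distances in \<open>[r1, r2]\<close>. This property survives
  small perturbations of the norm, so the configuration may be built in a space that is only finitely
  representable in the Banach space.

  Iterated limits along an ultrafilter of the norms of combinations of a separated bounded sequence
  give a spreading norm (one that ignores zero coefficients), and the differences of consecutive basis
  vectors are suppression unconditional. If the sums of basis vectors are bounded, James' distortion
  argument gives almost isometric copies of \<open>c\<^sub>0\<close>, where the configuration is explicit. Otherwise
  normalised long alternating sums give in the limit a spreading norm \<open>R\<close> that is also invariant under
  changes of signs. Either sums of basis vectors are bounded in \<open>R\<close>, and James' argument applies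
  again, or the distance of the indicators of finite sets \<open>S\<close> and \<open>T\<close> is an unbounded monotone
  function of the size of the symmetric difference of \<open>S\<close> and \<open>T\<close>; then one moves the sizes of
  the pairwise intersections, one element at a time.
\<close>

subsection \<open>Ultrafilters\<close>

definition ultra :: "'a filter \<Rightarrow> bool"
  where "ultra U \<longleftrightarrow> U \<noteq> bot \<and> (\<forall>P. eventually P U \<or> eventually (\<lambda>x. \<not> P x) U)"

text \<open>Zorn's lemma for the reversed order gives a minimal proper filter below
  \<open>F\<close>. Meeting it with \<open>P\<close> yields \<open>bot\<close> or the filter itself,
  so it decides \<open>P\<close>.\<close>

lemma exists_ultra_le:
  fixes F :: "'a filter"
  assumes "F \<noteq> bot"
  shows "\<exists>U. ultra U \<and> U \<le> F"
proof -
  define A where "A = {G. G \<noteq> bot \<and> G \<le> F}"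
  have "\<exists>m\<in>A. \<forall>a\<in>A. a \<le> m \<longrightarrow> a = m"
  proof (rule predicate_Zorn)
    show "partial_order_on A (relation_of (\<lambda>G H. H \<le> G) A)"
      by (rule partial_order_on_relation_ofI) auto
    fix C assume C: "C \<in> Chains (relation_of (\<lambda>G H. H \<le> G) A)"
    then have CA: "C \<subseteq> A" and tot: "\<And>G H. G \<in> C \<Longrightarrow> H \<in> C \<Longrightarrow> G \<le> H \<or> H \<le> G"
      unfolding Chains_def relation_of_def by auto
    show "\<exists>u\<in>A. \<forall>a\<in>C. u \<le> a"
    proof (cases "C = {}")
      case True
      then show ?thesis using assms by (auto simp: A_def)
    next
      case False
      \<comment> \<open>A nonempty chain is directed downwards, so what holds eventually for
        \<open>Inf C\<close> already does for a member of \<open>C\<close>.\<close>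
      have "\<not> eventually (\<lambda>x. False) (Inf C)"
      proof (subst eventually_Inf_base)
        show "\<exists>x\<in>C. x \<le> inf G H" if "G \<in> C" "H \<in> C" for G H
          using tot[OF that] that by auto
        show "\<not> (\<exists>b\<in>C. eventually (\<lambda>x. False) b)"
          using CA by (auto simp: A_def eventually_False)
      qed fact
      then have "Inf C \<noteq> bot" by (simp add: eventually_False)
      moreover have "Inf C \<le> F"
        using False CA by (auto simp: A_def intro: Inf_lower2)
      ultimately show ?thesis
        by (intro bexI[of _ "Inf C"]) (auto simp: A_def intro: Inf_lower)
    qed
  qed
  then obtain U where U: "U \<in> A" and min: "\<And>G. G \<in> A \<Longrightarrow> G \<le> U \<Longrightarrow> G = U" by blast
  have "eventually P U \<or> eventually (\<lambda>x. \<not> P x) U" for P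
  proof (cases "inf U (principal {x. P x}) = bot")
    case True
    then have "eventually (\<lambda>x. False) (inf U (principal {x. P x}))" by simp
    then show ?thesis by (simp add: eventually_inf_principal)
  next
    case False
    then have "inf U (principal {x. P x}) \<in> A"
      using U by (auto simp: A_def intro: le_infI1)
    then have "inf U (principal {x. P x}) = U" by (rule min) simp
    then have "U \<le> principal {x. P x}" by (metis inf.cobounded2)
    then show ?thesis by (simp add: le_principal)
  qed
  with U show ?thesis by (auto simp: ultra_def A_def)
qed

text \<open>Compactness gives a cluster point of \<open>f\<close> along \<open>U\<close>, and an
  ultrafilter converges to its cluster points.\<close>

lemma ultra_tendsto:
  fixes f :: "'a \<Rightarrow> real"
  assumes U: "ultra U" and bd: "\<And>k. \<bar>f k\<bar> \<le> B"
  shows "(f \<longlongrightarrow> Lim U f) U"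
proof -
  have "compact {-B..B}" by simp
  moreover have "filtermap f U \<noteq> bot" using U by (simp add: ultra_def filtermap_bot_iff)
  moreover have "eventually (\<lambda>x. x \<in> {-B..B}) (filtermap f U)"
    using bd by (auto simp: eventually_filtermap abs_le_iff intro!: always_eventually) (smt (verit) bd)
  ultimately obtain l where l: "inf (nhds l) (filtermap f U) \<noteq> bot"
    unfolding compact_filter by blast
  have "(f \<longlongrightarrow> l) U"
  proof (rule topological_tendstoI)
    fix S assume S: "open S" "l \<in> S"
    show "eventually (\<lambda>x. f x \<in> S) U"
    proof (rule ccontr)
      assume "\<not> ?thesis"
      then have "eventually (\<lambda>x. f x \<notin> S) U" using U by (auto simp: ultra_def)
      then have "eventually (\<lambda>y. y \<notin> S) (inf (nhds l) (filtermap f U))"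
        by (intro filter_leD[OF inf_le2]) (simp add: eventually_filtermap)
      moreover have "eventually (\<lambda>y. y \<in> S) (inf (nhds l) (filtermap f U))"
        using S by (intro filter_leD[OF inf_le1]) (auto simp: eventually_nhds)
      ultimately have "eventually (\<lambda>y. False) (inf (nhds l) (filtermap f U))"
        by eventually_elim simp
      with l show False by (simp add: eventually_False)
    qed
  qed
  moreover have "\<not> trivial_limit U" using U by (simp add: ultra_def)
  ultimately show ?thesis by (simp add: tendsto_Lim)
qed

subsection \<open>The Poincare-Miranda theorem\<close>

lemma tendsto_fun_componentwise:
  fixes a :: "'c \<Rightarrow> 'i \<Rightarrow> 'b::topological_space"
  assumes "\<And>j. ((\<lambda>k. a k j) \<longlongrightarrow> z j) F"
  shows "(a \<longlongrightarrow> z) F"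
proof -
  have "limitin (product_topology (\<lambda>i. euclidean) UNIV) a z F"
    unfolding limitin_componentwise using assms by (auto simp: extensional_def)
  then show ?thesis by (simp add: euclidean_product_topology)
qed

text \<open>Kuhn's combinatorial lemma on the grid of mesh \<open>1 / p\<close> finds one cell with,
  for each \<open>i\<close>, a vertex where \<open>f\<close> is nonpositive in coordinate
  \<open>i\<close> and one where it is nonnegative. The cells accumulate at a zero. The cube
  \<open>S\<close> has infinitely many coordinates but is compact by Tychonoff's theorem.\<close>

lemma poincare_miranda_nat:
  fixes f :: "(nat \<Rightarrow> real) \<Rightarrow> nat \<Rightarrow> real" and n :: nat
  defines "S \<equiv> {x. \<forall>i. 0 \<le> x i \<and> x i \<le> 1}"
  assumes cont: "\<And>i. i < n \<Longrightarrow> continuous_on S (\<lambda>x. f x i)"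
    and lo: "\<And>x i. x \<in> S \<Longrightarrow> i < n \<Longrightarrow> x i = 0 \<Longrightarrow> f x i \<le> 0"
    and hi: "\<And>x i. x \<in> S \<Longrightarrow> i < n \<Longrightarrow> x i = 1 \<Longrightarrow> 0 \<le> f x i"
  shows "\<exists>x\<in>S. \<forall>i<n. f x i = 0"
proof -
  define \<xi> :: "nat \<Rightarrow> (nat \<Rightarrow> nat) \<Rightarrow> nat \<Rightarrow> real"
    where "\<xi> p x j = (if j < n then x j / p else 0)" for p x j
  define Q where "Q p q r s \<longleftrightarrow> (\<forall>i<n. q i < p) \<and>
      (\<forall>i<n. (\<forall>j<n. q j \<le> r i j \<and> r i j \<le> q j + 1) \<and> (\<forall>j<n. q j \<le> s i j \<and> s i j \<le> q j + 1) \<and>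
         f (\<xi> p (r i)) i \<le> 0 \<and> 0 \<le> f (\<xi> p (s i)) i)" for p q r s
  have "\<exists>q r s. Q p q r s" if p: "p > 0" for p
  proof -
    \<comment> \<open>The boundary labels that Kuhn's lemma demands are forced: 0 at
      \<open>x i = 0\<close> and 1 at \<open>x i = p\<close>. By \<open>lo\<close> and
      \<open>hi\<close> the labels still tell the sign of \<open>f\<close>.\<close>
    define label where
      "label x i = (if x i = 0 \<or> (x i < p \<and> f (\<xi> p x) i \<le> 0) then 0 else 1 :: nat)" for x i
    have inS: "\<xi> p x \<in> S" if "\<forall>i<n. x i \<le> p" for x
      using that p by (auto simp: S_def \<xi>_def divide_simps)
    have l0: "f (\<xi> p x) i \<le> 0" if x: "\<forall>i<n. x i \<le> p" and "i < n" "label x i = 0" for x i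
    proof (cases "x i = 0")
      case True
      then show ?thesis using lo[OF inS[OF x] that(2)] that(2) by (simp add: \<xi>_def)
    qed (use that(3) in \<open>simp add: label_def split: if_splits\<close>)
    have l1: "0 \<le> f (\<xi> p x) i" if x: "\<forall>i<n. x i \<le> p" and "i < n" "label x i \<noteq> 0" for x i
    proof (cases "x i < p")
      case False
      then have "x i = p" using x[rule_format, OF that(2)] by simp
      then show ?thesis using hi[OF inS[OF x] that(2)] that(2) p by (simp add: \<xi>_def)
    qed (use that(3) in \<open>simp add: label_def split: if_splits\<close>)
    obtain q where q: "\<forall>i<n. q i < p"
      and ex: "\<forall>i<n. \<exists>r s. (\<forall>j<n. q j \<le> r j \<and> r j \<le> q j + 1) \<and>
             (\<forall>j<n. q j \<le> s j \<and> s j \<le> q j + 1) \<and> label r i \<noteq> label s i"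
      by (rule kuhn_lemma[of p n label]) (use p in \<open>auto simp: label_def\<close>)
    have "\<exists>r s. (\<forall>j<n. q j \<le> r j \<and> r j \<le> q j + 1) \<and> (\<forall>j<n. q j \<le> s j \<and> s j \<le> q j + 1) \<and>
         f (\<xi> p r) i \<le> 0 \<and> 0 \<le> f (\<xi> p s) i" if i: "i < n" for i
    proof -
      obtain r s where rs: "\<forall>j<n. q j \<le> r j \<and> r j \<le> q j + 1" "\<forall>j<n. q j \<le> s j \<and> s j \<le> q j + 1"
        "label r i \<noteq> label s i" 
        using ex[rule_format, OF i] by blast
      have b: "\<forall>j<n. r j \<le> p" "\<forall>j<n. s j \<le> p"
        using rs q by (metis Suc_leI Suc_eq_plus1 le_trans)+
      show ?thesis
      proof (cases "label r i = 0")
        case True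
        then have "label s i \<noteq> 0" using rs by simp
        then show ?thesis using l0[OF b(1) i True] l1[OF b(2) i] rs by blast
      next
        case False
        then have "label s i = 0" using rs by (auto simp: label_def split: if_splits)
        then show ?thesis using l0[OF b(2) i] l1[OF b(1) i False] rs by blast
      qed
    qed
    then obtain r s where "\<forall>i<n. (\<forall>j<n. q j \<le> r i j \<and> r i j \<le> q j + 1) \<and>
        (\<forall>j<n. q j \<le> s i j \<and> s i j \<le> q j + 1) \<and> f (\<xi> p (r i)) i \<le> 0 \<and> 0 \<le> f (\<xi> p (s i)) i"
      by metis
    then have "Q p q r s" using q by (simp add: Q_def)
    then show ?thesis by blast
  qed
  then obtain q r s where Q: "\<And>p. p > 0 \<Longrightarrow> Q p (q p) (r p) (s p)" by metis
  have q: "q p i < p" if "p > 0" "i < n" for p i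
    using Q[OF that(1)] that(2) by (simp add: Q_def)
  have rb: "q p j \<le> r p i j \<and> r p i j \<le> q p j + 1" and sb: "q p j \<le> s p i j \<and> s p i j \<le> q p j + 1"
    if "p > 0" "i < n" "j < n" for p i j
    using Q[OF that(1)] that(2,3) by (simp_all add: Q_def)
  have rf: "f (\<xi> p (r p i)) i \<le> 0" and sf: "0 \<le> f (\<xi> p (s p i)) i" if "p > 0" "i < n" for p i
    using Q[OF that(1)] that(2) by (simp_all add: Q_def)
  have "compactin (product_topology (\<lambda>i. euclidean) UNIV) (PiE UNIV (\<lambda>i::nat. {0..1::real}))"
    unfolding compactin_PiE by simp
  moreover have "PiE UNIV (\<lambda>i::nat. {0..1::real}) = S" by (auto simp: S_def PiE_UNIV_domain)
  ultimately have "compact S" by (simp add: euclidean_product_topology)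
  then have sc: "seq_compact S" by (rule compact_imp_seq_compact)
  have xiS: "\<xi> p x \<in> S" if "p > 0" "\<And>j. j < n \<Longrightarrow> x j \<le> p" for p x
    using that by (auto simp: S_def \<xi>_def divide_simps)
  have "\<forall>k. \<xi> (Suc k) (q (Suc k)) \<in> S"
    by (auto intro!: xiS less_imp_le q)
  then obtain z \<sigma> where z: "z \<in> S" and \<sigma>: "strict_mono \<sigma>"
    and lim: "((\<lambda>k. \<xi> (Suc k) (q (Suc k))) \<circ> \<sigma>) \<longlonglongrightarrow> z"
    by (rule seq_compactE[OF sc])
  define m where "m k = Suc (\<sigma> k)" for k
  have m0: "m k > 0" for k by (simp add: m_def)
  have inv: "(\<lambda>k. 1 / real (m k)) \<longlonglongrightarrow> 0"
    using LIMSEQ_subseq_LIMSEQ[OF LIMSEQ_inverse_real_of_nat \<sigma>] by (simp add: m_def o_def divide_inverse)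
  \<comment> \<open>The mesh tends to 0, so any choice of vertices in the cells converges to the
    limit \<open>z\<close> of the corners.\<close>
  have comp: "(\<lambda>k. \<xi> (m k) (t k)) \<longlonglongrightarrow> z"
    if t: "\<And>k j. j < n \<Longrightarrow> q (m k) j \<le> t k j \<and> t k j \<le> q (m k) j + 1" for t
  proof (rule tendsto_fun_componentwise)
    fix j
    have "(\<lambda>k. \<xi> (m k) (q (m k)) j) \<longlonglongrightarrow> z j"
      using lim continuous_on_tendsto_compose[OF continuous_on_product_coordinates, of _ z]
      by (auto simp: m_def o_def)
    moreover have "(\<lambda>k. \<xi> (m k) (t k) j - \<xi> (m k) (q (m k)) j) \<longlonglongrightarrow> 0"
    proof (rule tendsto_rabs_zero_cancel, rule tendsto_sandwich[OF _ _ tendsto_const inv])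
      have "\<bar>\<xi> (m k) (t k) j - \<xi> (m k) (q (m k)) j\<bar> \<le> 1 / real (m k)" for k
        using t[of j k] m0[of k] by (auto simp: \<xi>_def diff_divide_distrib[symmetric] divide_simps)
      then show "\<forall>\<^sub>F k in sequentially. \<bar>\<xi> (m k) (t k) j - \<xi> (m k) (q (m k)) j\<bar> \<le> 1 / real (m k)"
        by simp
    qed simp
    ultimately show "(\<lambda>k. \<xi> (m k) (t k) j) \<longlonglongrightarrow> z j"
      using tendsto_add by fastforce
  qed
  have le: "t \<le> p" if "q p j \<le> t \<and> t \<le> q p j + 1" "p > 0" "j < n" for p j t
    using q[of p j] that by linarith
  have "f z i = 0" if i: "i < n" for i
  proof -
    have "(\<lambda>k. f (\<xi> (m k) (r (m k) i)) i) \<longlonglongrightarrow> f z i"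
    proof (rule continuous_on_tendsto_compose[OF cont[OF i] comp z])
      show "q (m k) j \<le> r (m k) i j \<and> r (m k) i j \<le> q (m k) j + 1" if "j < n" for k j
        by (rule rb[OF m0 i that])
      have "\<xi> (m k) (r (m k) i) \<in> S" for k
        by (rule xiS[OF m0]) (rule le[OF rb[OF m0 i] m0])
      then show "\<forall>\<^sub>F k in sequentially. \<xi> (m k) (r (m k) i) \<in> S" by simp
    qed
    then have "f z i \<le> 0"
      by (rule LIMSEQ_le_const2) (use rf m0 i in auto)
    have "(\<lambda>k. f (\<xi> (m k) (s (m k) i)) i) \<longlonglongrightarrow> f z i"
    proof (rule continuous_on_tendsto_compose[OF cont[OF i] comp z])
      show "q (m k) j \<le> s (m k) i j \<and> s (m k) i j \<le> q (m k) j + 1" if "j < n" for k j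
        by (rule sb[OF m0 i that])
      have "\<xi> (m k) (s (m k) i) \<in> S" for k
        by (rule xiS[OF m0]) (rule le[OF sb[OF m0 i] m0])
      then show "\<forall>\<^sub>F k in sequentially. \<xi> (m k) (s (m k) i) \<in> S" by simp
    qed
    then have "0 \<le> f z i"
      by (rule LIMSEQ_le_const) (use sf m0 i in auto)
    with \<open>f z i \<le> 0\<close> show ?thesis by simp
  qed
  then show ?thesis using z by blast
qed

text \<open>Coordinates are renumbered by \<open>h\<close>. Off \<open>I\<close> the value
  \<open>h i\<close> is arbitrary, but all coordinates of a point of \<open>T\<close> lie in the
  unit interval, so the transported point is in \<open>S\<close>.\<close>

lemma poincare_miranda:
  fixes f :: "('i \<Rightarrow> real) \<Rightarrow> 'i \<Rightarrow> real"
  defines "S \<equiv> {x. \<forall>i. 0 \<le> x i \<and> x i \<le> 1}"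
  assumes I: "finite I" and cont: "\<And>i. i \<in> I \<Longrightarrow> continuous_on S (\<lambda>x. f x i)"
    and lo: "\<And>x i. x \<in> S \<Longrightarrow> i \<in> I \<Longrightarrow> x i = 0 \<Longrightarrow> f x i \<le> 0"
    and hi: "\<And>x i. x \<in> S \<Longrightarrow> i \<in> I \<Longrightarrow> x i = 1 \<Longrightarrow> 0 \<le> f x i"
  shows "\<exists>x\<in>S. \<forall>i\<in>I. f x i = 0"
proof -
  obtain h where h: "bij_betw h I {..<card I}"
    using ex_bij_betw_finite_nat[OF I] by (auto simp: atLeast0LessThan)
  define g where "g = inv_into I h"
  have g: "g k \<in> I" "h (g k) = k" if "k < card I" for k
    using h that unfolding g_def bij_betw_def by (auto simp: f_inv_into_f inv_into_into)
  have hI: "h i < card I" "g (h i) = i" if "i \<in> I" for i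
    using h that unfolding g_def bij_betw_def by auto
  define T where "T = {x. \<forall>k::nat. 0 \<le> x k \<and> x k \<le> (1::real)}"
  have sub: "(\<lambda>i. x (h i)) \<in> S" if "x \<in> T" for x using that by (auto simp: S_def T_def)
  have c: "continuous_on T (\<lambda>x. f (\<lambda>i. x (h i)) (g k))" if "k < card I" for k
  proof (rule continuous_on_compose2[OF cont[OF g(1)[OF that]]])
    show "continuous_on T (\<lambda>x i. x (h i))"
      by (intro continuous_on_coordinatewise_then_product
          continuous_on_subset[OF continuous_on_product_coordinates]) auto
  qed (use sub in auto)
  have "\<exists>x\<in>T. \<forall>k<card I. f (\<lambda>i. x (h i)) (g k) = 0"
    unfolding T_def
    by (rule poincare_miranda_nat) (use c lo hi g sub in \<open>auto simp: T_def\<close>)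
  then show ?thesis using hI sub by metis
qed

subsection \<open>Spreading norms and finite representability\<close>

text \<open>A seminorm on finitely supported sequences, given on lists of all lengths at once. By
  \<open>insert_zero\<close> the positions of the nonzero coefficients do not matter, only their
  order; this is the spreading property.\<close>

locale list_norm =
  fixes P :: "real list \<Rightarrow> real"
  assumes add_le: "length a = length b \<Longrightarrow> P (map2 (+) a b) \<le> P a + P b"
    and scale: "P (map ((*) r) a) = \<bar>r\<bar> * P a"
    and insert_zero: "P (a @ 0 # b) = P (a @ b)"
begin

lemma map_add_le: "P (map (\<lambda>s. f s + g s) sl) \<le> P (map f sl) + P (map g sl)"
  using add_le[of "map f sl" "map g sl"] by (simp add: map2_map_map)

lemma map_scale: "P (map (\<lambda>s. r * f s) sl) = \<bar>r\<bar> * P (map f sl)"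
  using scale[of r "map f sl"] by (simp add: o_def)

lemma map_diff_le: "P (map (\<lambda>s. f s - g s) sl) \<le> P (map f sl) + P (map g sl)"
  using map_add_le[of f "\<lambda>s. - 1 * g s" sl] map_scale[of "-1" g sl] by simp

lemma nonneg: "0 \<le> P a"
proof -
  have "P (map (\<lambda>s. 0 * s) a) \<le> 2 * P a"
    using map_diff_le[of id id a] by simp
  then show ?thesis unfolding map_scale by simp
qed

lemma filter_nonzero: "P (a @ c) = P (a @ filter (\<lambda>x. x \<noteq> 0) c)"
proof (induction c arbitrary: a)
  case (Cons x c)
  show ?case
    using Cons[of "a @ [x]"] Cons[of a] insert_zero[of a c] by (cases "x = 0") simp_all
qed simp

lemma insert_zeros: "P (a @ replicate k 0 @ b) = P (a @ b)"
  using filter_nonzero[of a "replicate k 0 @ b"] filter_nonzero[of a b] by simp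

lemma single: "P [x] = \<bar>x\<bar> * P [1]"
  using scale[of x "[1]"] by simp

lemma le_sum_abs: "P c \<le> P [1] * (\<Sum>x\<leftarrow>c. \<bar>x\<bar>)"
proof (induction c)
  case Nil
  have "P [] = 0" using scale[of 0 "[]"] by simp
  then show ?case by simp
next
  case (Cons x c)
  have "P (x # c) = P (map2 (+) (x # replicate (length c) 0) (0 # c))"
    by (simp add: map2_map_map zip_replicate1 o_def)
  also have "\<dots> \<le> P (x # replicate (length c) 0) + P (0 # c)"
    by (rule add_le) simp
  also have "P (x # replicate (length c) 0) = P [x]"
    using insert_zeros[of "[x]" "length c" "[]"] by simp
  also have "P (0 # c) = P c" using insert_zero[of "[]" c] by simp
  finally show ?case using Cons single[of x] by (simp add: algebra_simps)
qed

end

text \<open>\<open>\<lambda>c. P (block w c)\<close> is \<open>P\<close> on the block basis formed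
  by successive copies of \<open>w\<close>.\<close>

definition block :: "real list \<Rightarrow> real list \<Rightarrow> real list"
  where "block w c = concat (map (\<lambda>a. map ((*) a) w) c)"

lemma block_simps [simp]:
  "block w [] = []" "block w (a # c) = map ((*) a) w @ block w c"
  "block w (c @ d) = block w c @ block w d"
  by (simp_all add: block_def)

lemma length_block [simp]: "length (block w c) = length c * length w"
  by (induction c) simp_all

lemma block_add:
  "length a = length b \<Longrightarrow> block w (map2 (+) a b) = map2 (+) (block w a) (block w b)"
  by (induction a b rule: list_induct2) (simp_all add: map2_map_map distrib_right)

lemma block_scale: "block w (map ((*) r) a) = map ((*) r) (block w a)"
  by (induction a) (simp_all add: o_def mult.assoc)

lemma list_norm_block:
  assumes "list_norm P"
  shows "list_norm (\<lambda>c. P (block w c))"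
proof -
  interpret list_norm P by fact
  show ?thesis
  proof
    fix a b :: "real list" and r
    show "length a = length b \<Longrightarrow> P (block w (map2 (+) a b)) \<le> P (block w a) + P (block w b)"
      by (simp add: block_add add_le)
    show "P (block w (map ((*) r) a)) = \<bar>r\<bar> * P (block w a)"
      by (simp add: block_scale scale)
    have "map ((*) 0) w = replicate (length w) (0::real)"
      by (induction w) simp_all
    then show "P (block w (a @ 0 # b)) = P (block w (a @ b))"
      using insert_zeros[of "block w a" "length w" "block w b"] by simp
  qed
qed

lemma list_norm_scale:
  assumes "list_norm P" "0 \<le> r"
  shows "list_norm (\<lambda>c. r * P c)"
proof -
  interpret list_norm P by fact
  show ?thesis
    by unfold_locales (use assms add_le in
        \<open>auto simp: scale insert_zero distrib_left[symmetric] intro!: mult_left_mono\<close>)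
qed

lemma list_norm_Lim:
  assumes U: "ultra U" and P: "\<And>h. list_norm (P h)" and bd: "\<And>h c. P h c \<le> B c"
  shows "((\<lambda>h. P h c) \<longlongrightarrow> Lim U (\<lambda>h. P h c)) U"
    and "list_norm (\<lambda>c. Lim U (\<lambda>h. P h c))"
proof -
  have lim: "((\<lambda>h. P h c) \<longlongrightarrow> Lim U (\<lambda>h. P h c)) U" for c
    by (rule ultra_tendsto[OF U, of _ "B c"]) (use list_norm.nonneg[OF P] bd in auto)
  then show "((\<lambda>h. P h c) \<longlongrightarrow> Lim U (\<lambda>h. P h c)) U" .
  have nt: "U \<noteq> bot" using U by (simp add: ultra_def)
  show "list_norm (\<lambda>c. Lim U (\<lambda>h. P h c))"
  proof
    fix a b :: "real list" and r
    show "Lim U (\<lambda>h. P h (map2 (+) a b)) \<le> Lim U (\<lambda>h. P h a) + Lim U (\<lambda>h. P h b)"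
      if "length a = length b"
      by (rule tendsto_le[OF nt tendsto_add[OF lim lim] lim]) (simp add: that list_norm.add_le[OF P])
    show "Lim U (\<lambda>h. P h (map ((*) r) a)) = \<bar>r\<bar> * Lim U (\<lambda>h. P h a)"
      unfolding list_norm.scale[OF P] using nt tendsto_mult_left[OF lim] by (intro tendsto_Lim) auto
    show "Lim U (\<lambda>h. P h (a @ 0 # b)) = Lim U (\<lambda>h. P h (a @ b))"
      by (simp add: list_norm.insert_zero[OF P])
  qed
qed

section \<open>Finite representability in a normed space\<close>

definition lincomb :: "real list \<Rightarrow> 'b::real_vector list \<Rightarrow> 'b"
  where "lincomb c ys = sum_list (map2 scaleR c ys)"

lemma lincomb_simps [simp]:
  "lincomb [] ys = 0" "lincomb c [] = 0" "lincomb (a # c) (y # ys) = a *\<^sub>R y + lincomb c ys"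
  by (simp_all add: lincomb_def)

lemma lincomb_append:
  "length c = length ys \<Longrightarrow> lincomb (c @ d) (ys @ zs) = lincomb c ys + lincomb d zs"
  by (simp add: lincomb_def)

lemma lincomb_scale: "lincomb (map ((*) r) c) ys = r *\<^sub>R lincomb c ys"
proof (induction c arbitrary: ys)
  case (Cons a c)
  then show ?case by (cases ys) (simp_all add: scaleR_add_right)
qed simp

lemma lincomb_scale_right: "lincomb c (map (scaleR r) ys) = r *\<^sub>R lincomb c ys"
proof (induction c arbitrary: ys)
  case (Cons a c)
  then show ?case by (cases ys) (simp_all add: scaleR_add_right)
qed simp

lemma lincomb_map_diff:
  "lincomb (map (\<lambda>s. f s - g s) sl) ys = lincomb (map f sl) ys - lincomb (map g sl) ys"
proof (induction sl arbitrary: ys)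
  case (Cons a c)
  then show ?case by (cases ys) (simp_all add: algebra_simps)
qed simp

lemma norm_lincomb_le:
  fixes ys :: "'b::real_normed_vector list"
  assumes "\<And>y. y \<in> set ys \<Longrightarrow> norm y \<le> K"
  shows "norm (lincomb c ys) \<le> K * (\<Sum>x\<leftarrow>take (length ys) c. \<bar>x\<bar>)"
  using assms
proof (induction ys arbitrary: c)
  case (Cons y ys)
  show ?case
  proof (cases c)
    case (Cons a d)
    have "norm (lincomb c (y # ys)) \<le> \<bar>a\<bar> * norm y + norm (lincomb d ys)"
      unfolding Cons by (simp add: norm_triangle_le)
    also have "\<dots> \<le> \<bar>a\<bar> * K + K * (\<Sum>x\<leftarrow>take (length ys) d. \<bar>x\<bar>)"
      using Cons.prems Cons.IH[of d] by (intro add_mono mult_left_mono) auto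
    finally show ?thesis by (simp add: Cons algebra_simps)
  qed simp
qed simp

lemma lincomb_unit:
  assumes "length ys = m" "i < m"
  shows "lincomb ((replicate m 0)[i := 1]) ys = ys ! i"
proof -
  have "lincomb ((replicate m 0)[i := 1]) ys = (\<Sum>j<m. (replicate m 0)[i := 1] ! j *\<^sub>R ys ! j)"
    using assms unfolding lincomb_def by (simp add: sum_list_sum_nth atLeast0LessThan)
  also have "\<dots> = (\<Sum>j<m. if j = i then ys ! j else 0)"
    by (intro sum.cong) (auto simp: nth_list_update)
  finally show ?thesis using assms by simp
qed

lemma continuous_on_lincomb:
  fixes ys :: "'b::real_normed_vector list"
  assumes "\<And>s. s \<in> set sl \<Longrightarrow> continuous_on S (\<lambda>t. v t s)"
  shows "continuous_on S (\<lambda>t. lincomb (map (v t) sl) ys)"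
  using assms
proof (induction sl arbitrary: ys)
  case (Cons a sl)
  then show ?case by (cases ys) (auto intro!: continuous_intros)
qed simp

text \<open>Comparing finitely many lists at a time, up to an additive error, is a weak form that
  passes easily to block bases and to limits; \<open>fin_rep_box\<close> strengthens it to uniform
  approximation on boxes.\<close>

definition fin_rep :: "'b::real_normed_vector itself \<Rightarrow> (real list \<Rightarrow> real) \<Rightarrow> bool"
  where "fin_rep _ P \<longleftrightarrow> (\<forall>m F \<epsilon>. finite F \<longrightarrow> (\<forall>c\<in>F. length c = m) \<longrightarrow> 0 < \<epsilon> \<longrightarrow>
    (\<exists>ys :: 'b list. length ys = m \<and> (\<forall>c\<in>F. \<bar>P c - norm (lincomb c ys)\<bar> < \<epsilon>)))"

fun group_lincomb :: "real list \<Rightarrow> nat \<Rightarrow> 'b::real_vector list \<Rightarrow> 'b list"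
  where "group_lincomb w 0 ys = []"
  | "group_lincomb w (Suc m) ys =
      lincomb w (take (length w) ys) # group_lincomb w m (drop (length w) ys)"

lemma length_group_lincomb [simp]: "length (group_lincomb w m ys) = m"
  by (induction m arbitrary: ys) simp_all

lemma lincomb_block:
  "length ys = length c * length w \<Longrightarrow> lincomb (block w c) ys = lincomb c (group_lincomb w (length c) ys)"
proof (induction c arbitrary: ys)
  case (Cons a c)
  have "lincomb (block w (a # c)) (take (length w) ys @ drop (length w) ys) =
      lincomb (map ((*) a) w) (take (length w) ys) + lincomb (block w c) (drop (length w) ys)"
    using Cons.prems by (simp del: append_take_drop_id add: lincomb_append)
  then show ?case using Cons by (simp add: lincomb_scale)
qed simp

lemma fin_rep_block:
  assumes "fin_rep TYPE('b::real_normed_vector) P"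
  shows "fin_rep TYPE('b) (\<lambda>c. P (block w c))"
  unfolding fin_rep_def
proof (intro allI impI)
  fix m and F :: "real list set" and \<epsilon> :: real assume F: "finite F" "\<forall>c\<in>F. length c = m" "0 < \<epsilon>"
  have "\<forall>c\<in>block w ` F. length c = m * length w" using F(2) by simp
  then obtain ys :: "'b list" where ys: "length ys = m * length w"
    "\<forall>c\<in>block w ` F. \<bar>P c - norm (lincomb c ys)\<bar> < \<epsilon>"
    using assms[unfolded fin_rep_def] F(1,3) by blast
  then have "\<forall>c\<in>F. \<bar>P (block w c) - norm (lincomb c (group_lincomb w m ys))\<bar> < \<epsilon>"
    using F(2) by (auto simp flip: lincomb_block)
  then show "\<exists>ys :: 'b list. length ys = m \<and> (\<forall>c\<in>F. \<bar>P (block w c) - norm (lincomb c ys)\<bar> < \<epsilon>)"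
    by (intro exI[of _ "group_lincomb w m ys"]) simp
qed

lemma fin_rep_scale:
  assumes "fin_rep TYPE('b::real_normed_vector) P" and r: "0 \<le> r"
  shows "fin_rep TYPE('b) (\<lambda>c. r * P c)"
  unfolding fin_rep_def
proof (intro allI impI)
  fix m and F :: "real list set" and \<epsilon> :: real assume F: "finite F" "\<forall>c\<in>F. length c = m" "0 < \<epsilon>"
  have "0 < \<epsilon> / (r + 1)" using F r by simp
  then obtain ys :: "'b list" where ys: "length ys = m"
    "\<forall>c\<in>F. \<bar>P c - norm (lincomb c ys)\<bar> < \<epsilon> / (r + 1)"
    using assms(1)[unfolded fin_rep_def, rule_format, of F m "\<epsilon> / (r + 1)"] F by auto
  have "\<bar>r * P c - norm (lincomb c (map (scaleR r) ys))\<bar> < \<epsilon>" if "c \<in> F" for c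
  proof -
    have "\<bar>r * P c - norm (lincomb c (map (scaleR r) ys))\<bar> = r * \<bar>P c - norm (lincomb c ys)\<bar>"
      using r by (simp add: lincomb_scale_right abs_mult flip: right_diff_distrib)
    also have "\<dots> \<le> r * (\<epsilon> / (r + 1))" using ys that r by (intro mult_left_mono) (auto intro: less_imp_le)
    also have "\<dots> < \<epsilon>" using r F by (simp add: field_simps)
    finally show ?thesis .
  qed
  then show "\<exists>ys :: 'b list. length ys = m \<and> (\<forall>c\<in>F. \<bar>r * P c - norm (lincomb c ys)\<bar> < \<epsilon>)"
    using ys by (intro exI[of _ "map (scaleR r) ys"]) simp
qed

lemma fin_rep_tendsto:
  assumes rep: "\<And>h. fin_rep TYPE('b::real_normed_vector) (P h)" and U: "U \<noteq> bot"
    and lim: "\<And>c. ((\<lambda>h. P h c) \<longlongrightarrow> Q c) U"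
  shows "fin_rep TYPE('b) Q"
  unfolding fin_rep_def
proof (intro allI impI)
  fix m and F :: "real list set" and \<epsilon> :: real assume F: "finite F" "\<forall>c\<in>F. length c = m" "0 < \<epsilon>"
  have "\<forall>c\<in>F. eventually (\<lambda>h. \<bar>P h c - Q c\<bar> < \<epsilon> / 2) U"
    using tendstoD[OF lim, of "\<epsilon> / 2"] F by (simp add: dist_real_def)
  then have "eventually (\<lambda>h. \<forall>c\<in>F. \<bar>P h c - Q c\<bar> < \<epsilon> / 2) U"
    using F by (intro eventually_ball_finite) auto
  then obtain h where h: "\<forall>c\<in>F. \<bar>P h c - Q c\<bar> < \<epsilon> / 2"
    using U eventually_happens' by blast
  obtain ys :: "'b list" where ys: "length ys = m"
    "\<forall>c\<in>F. \<bar>P h c - norm (lincomb c ys)\<bar> < \<epsilon> / 2"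
    using rep[of h, unfolded fin_rep_def, rule_format, of F m "\<epsilon> / 2"] F by auto
  have "\<bar>Q c - norm (lincomb c ys)\<bar> < \<epsilon>" if "c \<in> F" for c
    using h[rule_format, OF that] ys(2)[rule_format, OF that] by linarith
  then show "\<exists>ys :: 'b list. length ys = m \<and> (\<forall>c\<in>F. \<bar>Q c - norm (lincomb c ys)\<bar> < \<epsilon>)"
    using ys by blast
qed

lemma floor_box: "\<lfloor>p\<rfloor> \<in> {- \<lceil>q\<rceil> - 1..\<lceil>q\<rceil> + 1}" if "\<bar>p\<bar> \<le> q" for p q :: real
proof -
  have "p \<le> q" "- q \<le> p" using that by auto
  then show ?thesis unfolding atLeastAtMost_iff by linarith
qed

text \<open>Entries are rounded to a finite grid, where \<open>fin_rep\<close> applies with error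
  \<open>\<epsilon> / 2\<close>. Both norms are at most a constant times the sum of absolute values,
  so rounding costs \<open>\<epsilon> / 4\<close> in each.\<close>

lemma fin_rep_box:
  assumes P: "list_norm P" and rep: "fin_rep TYPE('b::real_normed_vector) P" and \<epsilon>: "0 < \<epsilon>"
  shows "\<exists>ys :: 'b list. length ys = m \<and>
    (\<forall>c. length c = m \<longrightarrow> (\<forall>x\<in>set c. \<bar>x\<bar> \<le> B) \<longrightarrow> \<bar>P c - norm (lincomb c ys)\<bar> \<le> \<epsilon>)"
proof -
  interpret list_norm P by fact
  define \<kappa> where "\<kappa> = P [1] + \<epsilon>"
  have \<kappa>: "0 < \<kappa>" using nonneg[of "[1]"] \<epsilon> by (simp add: \<kappa>_def)
  \<comment> \<open>Rounding moves each of \<open>m\<close> entries by at most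
    \<open>\<eta>\<close>, and \<open>\<kappa>\<close> will bound \<open>P [1]\<close> as well as
    the norms of the vectors found; hence
    \<open>\<kappa> * m * \<eta> \<le> \<epsilon> / 4\<close>.\<close>
  define \<eta> where "\<eta> = \<epsilon> / (4 * \<kappa> * (m + 1))"
  have \<eta>: "0 < \<eta>" using \<epsilon> \<kappa> by (simp add: \<eta>_def)
  \<comment> \<open>The values 0 and 1 are added to put the unit lists into \<open>F\<close>; these
    bound the norm of each single vector.\<close>
  define G where "G = (\<lambda>k. \<eta> * of_int k) ` {- \<lceil>B / \<eta>\<rceil> - 1..\<lceil>B / \<eta>\<rceil> + 1} \<union> {0, 1}"
  define F where "F = {c. set c \<subseteq> G \<and> length c = m}"
  have "finite F" unfolding F_def by (rule finite_lists_length_eq) (simp add: G_def)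
  moreover have "\<forall>c\<in>F. length c = m" "0 < \<epsilon> / 2" using \<epsilon> by (auto simp: F_def)
  ultimately have "\<exists>ys :: 'b list. length ys = m \<and> (\<forall>c\<in>F. \<bar>P c - norm (lincomb c ys)\<bar> < \<epsilon> / 2)"
    using rep unfolding fin_rep_def by blast
  then obtain ys :: "'b list" where ys: "length ys = m"
    and F: "\<And>c. c \<in> F \<Longrightarrow> \<bar>P c - norm (lincomb c ys)\<bar> < \<epsilon> / 2"
    by blast
  have norm_y: "norm y \<le> \<kappa>" if y: "y \<in> set ys" for y
  proof -
    obtain i where i: "i < m" "y = ys ! i" using y ys by (auto simp: in_set_conv_nth)
    define u where "u = (replicate m (0::real))[i := 1]"
    have u: "u = replicate i 0 @ 1 # replicate (m - Suc i) 0"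
      using i by (simp add: u_def upd_conv_take_nth_drop min_def)
    have "set u \<subseteq> {0, 1}" unfolding u by auto
    then have "u \<in> F" by (auto simp: F_def G_def u_def)
    moreover have "P u = P [1]"
      using insert_zeros[of "[]" i "1 # replicate (m - Suc i) 0"] insert_zeros[of "[1]" "m - Suc i" "[]"]
      by (simp add: u)
    moreover have "lincomb u ys = y" using lincomb_unit[OF ys i(1)] i by (simp add: u_def)
    ultimately have "\<bar>P [1] - norm y\<bar> < \<epsilon> / 2" using F[of u] by simp
    then show ?thesis using \<epsilon> unfolding \<kappa>_def by linarith
  qed
  have "\<bar>P c - norm (lincomb c ys)\<bar> \<le> \<epsilon>" if c: "length c = m" "\<forall>x\<in>set c. \<bar>x\<bar> \<le> B" for c
  proof -
    define g where "g x = \<eta> * of_int \<lfloor>x / \<eta>\<rfloor>" for x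
    have gx: "\<bar>x - g x\<bar> \<le> \<eta>" for x
    proof -
      have "x = \<eta> * (x / \<eta>)" using \<eta> by simp
      then have "x - g x = \<eta> * (x / \<eta> - of_int \<lfloor>x / \<eta>\<rfloor>)" by (simp add: g_def right_diff_distrib)
      also have "\<bar>\<dots>\<bar> \<le> \<eta> * 1"
        using \<eta> unfolding abs_mult by (intro mult_mono) linarith+
      finally show ?thesis by simp
    qed
    have "g x \<in> G" if "x \<in> set c" for x
    proof -
      have "\<bar>x / \<eta>\<bar> \<le> B / \<eta>" using c(2) that \<eta> by (auto simp: abs_divide divide_right_mono)
      then have "\<lfloor>x / \<eta>\<rfloor> \<in> {- \<lceil>B / \<eta>\<rceil> - 1..\<lceil>B / \<eta>\<rceil> + 1}" 
        by (rule floor_box)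
      then show ?thesis by (auto simp: G_def g_def)
    qed
    then have gF: "map g c \<in> F" using c by (auto simp: F_def)
    define e where "e = map (\<lambda>x. x - g x) c"
    have "(\<Sum>x\<leftarrow>e. \<bar>x\<bar>) \<le> (\<Sum>x\<leftarrow>c. \<eta>)"
      unfolding e_def map_map by (rule sum_list_mono) (simp add: gx)
    then have e: "(\<Sum>x\<leftarrow>e. \<bar>x\<bar>) \<le> m * \<eta>" using c by (simp add: sum_list_triv)
    have Ke: "\<kappa> * (\<Sum>x\<leftarrow>e. \<bar>x\<bar>) \<le> \<epsilon> / 4"
    proof -
      have "\<kappa> * (\<Sum>x\<leftarrow>e. \<bar>x\<bar>) \<le> \<kappa> * (m * \<eta>)" using e \<kappa> by (intro mult_left_mono) auto
      also have "\<dots> = \<epsilon> / 4 * (real m / (real m + 1))"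
        using \<kappa> by (simp add: \<eta>_def divide_simps)
      also have "\<dots> \<le> \<epsilon> / 4 * 1" using \<epsilon> by (intro mult_left_mono) auto
      finally show ?thesis by simp
    qed
    have "P e \<le> P [1] * (\<Sum>x\<leftarrow>e. \<bar>x\<bar>)" by (rule le_sum_abs)
    also have "\<dots> \<le> \<kappa> * (\<Sum>x\<leftarrow>e. \<bar>x\<bar>)"
      using \<epsilon> by (intro mult_right_mono) (auto simp: \<kappa>_def intro!: sum_list_nonneg)
    finally have Pe: "P e \<le> \<epsilon> / 4" using Ke by simp
    have "length e = length ys" using c ys by (simp add: e_def)
    then have ne: "norm (lincomb e ys) \<le> \<epsilon> / 4"
      using norm_lincomb_le[OF norm_y, of ys e] Ke by simp
    have "P c \<le> P e + P (map g c)" "P (map g c) \<le> P c + P e"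
      using map_add_le[of "\<lambda>x. x - g x" g c] map_diff_le[of id "\<lambda>x. x - g x" c] by (simp_all add: e_def)
    moreover have "lincomb e ys = lincomb c ys - lincomb (map g c) ys"
      using lincomb_map_diff[of id g c ys] by (simp add: e_def)
    then have "\<bar>norm (lincomb c ys) - norm (lincomb (map g c) ys)\<bar> \<le> \<epsilon> / 4"
      using ne norm_triangle_ineq3[of "lincomb c ys" "lincomb (map g c) ys"] by simp
    ultimately show ?thesis using F[OF gF] Pe by linarith
  qed
  then show ?thesis using ys by blast
qed

text \<open>Add \<open>k\<close> copies of the longer list, shifting the pair \<open>c\<close>,
  \<open>- c\<close> by one place each time: the middle telescopes to a single pair, while
  \<open>A\<close> and \<open>B\<close> are multiplied by \<open>k\<close>. Removing that pair costs
  \<open>P [- c, c]\<close> whatever \<open>k\<close> is, and dividing by \<open>k\<close> makes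
  this negligible. It is the suppression unconditionality of the differences.\<close>

lemma (in list_norm) remove_difference: "P (A @ B) \<le> P (A @ c # - c # B)"
proof -
  let ?V = "P (A @ c # - c # B)"
  have step: "P (map ((*) (real (Suc k))) A @ c # - c # map ((*) (real (Suc k))) B) \<le> real (Suc k) * ?V" for k
  proof (induction k)
    case (Suc k)
    let ?k = "real (Suc k)"
    have add: "map ((*) (real (Suc (Suc k)))) xs = map2 (+) (map ((*) ?k) xs) xs" for xs
      by (induction xs) (simp_all add: distrib_right)
    have "P (map ((*) (real (Suc (Suc k)))) A @ c # - c # map ((*) (real (Suc (Suc k)))) B) =
        P ((map ((*) (real (Suc (Suc k)))) A @ [c]) @ 0 # - c # map ((*) (real (Suc (Suc k)))) B)"
      by (subst insert_zero) simp
    also have "\<dots> = P (map2 (+) (map ((*) ?k) A @ c # - c # 0 # map ((*) ?k) B) (A @ 0 # c # - c # B))"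
      by (simp add: add del: of_nat_Suc)
    also have "\<dots> \<le> P (map ((*) ?k) A @ c # - c # 0 # map ((*) ?k) B) + P (A @ 0 # c # - c # B)"
      by (rule add_le) simp
    also have "P (map ((*) ?k) A @ c # - c # 0 # map ((*) ?k) B) = P (map ((*) ?k) A @ c # - c # map ((*) ?k) B)"
      using insert_zero[of "map ((*) ?k) A @ [c, - c]" "map ((*) ?k) B"] by simp
    also have "P (A @ 0 # c # - c # B) = ?V" by (rule insert_zero)
    also note Suc
    also have "?k * ?V + ?V = real (Suc (Suc k)) * ?V" by (simp add: algebra_simps)
    finally show ?case by simp
  qed (simp add: map_idI)
  have "real (Suc k) * P (A @ B) \<le> real (Suc k) * ?V + P [- c, c]" for k
  proof -
    let ?k = "real (Suc k)"
    have "?k * P (A @ B) = P (map ((*) ?k) (A @ 0 # 0 # B))"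
      by (simp only: scale insert_zero abs_of_nat)
    also have "map ((*) ?k) (A @ 0 # 0 # B) =
        map2 (+) (map ((*) ?k) A @ c # - c # map ((*) ?k) B)
          (replicate (length A) 0 @ - c # c # replicate (length B) 0)"
      by (simp add: zip_replicate2 o_def)
    also have "P \<dots> \<le> P (map ((*) ?k) A @ c # - c # map ((*) ?k) B) +
        P (replicate (length A) 0 @ - c # c # replicate (length B) 0)"
      by (rule add_le) simp
    also have "P (replicate (length A) 0 @ - c # c # replicate (length B) 0) = P [- c, c]"
      using insert_zeros[of "[]" "length A" "- c # c # replicate (length B) 0"]
        insert_zeros[of "[- c, c]" "length B" "[]"] by simp
    also note step
    finally show ?thesis by simp
  qed
  then have bd: "real (Suc k) * (P (A @ B) - ?V) \<le> P [- c, c]" for k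
    unfolding right_diff_distrib by (simp only: diff_le_eq add.commute)
  show ?thesis
  proof (rule ccontr)
    assume "\<not> ?thesis"
    then have pos: "0 < P (A @ B) - ?V" by simp
    then obtain k where "P [- c, c] < real k * (P (A @ B) - ?V)" using reals_Archimedean3 by blast
    also have "\<dots> \<le> real (Suc k) * (P (A @ B) - ?V)" using pos by (intro mult_right_mono) auto
    finally show False using bd[of k] by simp
  qed
qed

subsection \<open>A spreading norm from a separated sequence\<close>

text \<open>The positive distance \<open>d\<close> from \<open>v\<close> to the closed
  \<open>span B\<close> controls the coefficient of \<open>v\<close>. Along a convergent sequence
  these coefficients are therefore Cauchy, and what remains converges in
  \<open>span B\<close>.\<close>

lemma closed_span_finite:
  fixes B :: "'b::real_normed_vector set"
  assumes "finite B"
  shows "closed (span B)"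
  using assms
proof induction
  case (insert v B)
  show ?case
  proof (cases "v \<in> span B")
    case True
    then show ?thesis using insert by (simp add: span_redundant)
  next
    case False
    define d where "d = infdist v (span B)"
    have ne: "span B \<noteq> {}" using span_zero by blast
    have d: "0 < d"
      using False insert.IH ne infdist_pos_not_in_closed unfolding d_def by blast
    have lower: "\<bar>a\<bar> * d \<le> norm u" if u: "u - a *\<^sub>R v \<in> span B" for u a
    proof (cases "a = 0")
      case False
      have "v - (1 / a) *\<^sub>R u \<in> span B"
        using span_scale[OF u, of "- 1 / a"] False by (simp add: algebra_simps)
      then have "d \<le> dist v (v - (1 / a) *\<^sub>R u)" unfolding d_def by (rule infdist_le)
      then show ?thesis using False by (simp add: dist_norm field_simps)
    qed simp
    show ?thesis unfolding closed_sequential_limits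
    proof (intro allI impI, elim conjE)
      fix u y assume u: "\<forall>n::nat. u n \<in> span (insert v B)" and lim: "u \<longlonglongrightarrow> y"
      then have "\<forall>n. \<exists>a. u n - a *\<^sub>R v \<in> span B" by (auto simp: span_insert)
      then obtain a where a: "\<And>n. u n - a n *\<^sub>R v \<in> span B" by metis
      have "Cauchy a"
      proof (rule CauchyI)
        fix e :: real assume "0 < e"
        then have "0 < e * d" using d by simp
        then obtain M where M: "\<And>m n. m \<ge> M \<Longrightarrow> n \<ge> M \<Longrightarrow> norm (u m - u n) < e * d"
          using LIMSEQ_imp_Cauchy[OF lim] by (meson CauchyD)
        have "norm (a m - a n) < e" if mn: "m \<ge> M" "n \<ge> M" for m n
        proof -
          have "(u m - u n) - (a m - a n) *\<^sub>R v \<in> span B"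
            using span_diff[OF a[of m] a[of n]] by (simp add: algebra_simps)
          then have "\<bar>a m - a n\<bar> * d < e * d" using lower M[OF mn] by fastforce
          then show ?thesis using d by simp
        qed
        then show "\<exists>M. \<forall>m\<ge>M. \<forall>n\<ge>M. norm (a m - a n) < e" by blast
      qed
      then obtain l where "a \<longlonglongrightarrow> l" using Cauchy_convergent convergent_def by blast
      then have "(\<lambda>n. u n - a n *\<^sub>R v) \<longlonglongrightarrow> y - l *\<^sub>R v"
        by (intro tendsto_intros lim)
      then have "y - l *\<^sub>R v \<in> span B"
        using closed_sequentially[OF insert.IH, of "\<lambda>n. u n - a n *\<^sub>R v"] a by blast
      then show "y \<in> span (insert v B)" by (auto simp: span_insert)
    qed
  qed
qed simp

text \<open>Riesz's lemma: for \<open>v\<close> at distance \<open>d > 0\<close> from the closed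
  span, take \<open>b\<close> in the span at distance less than \<open>2 * d\<close> from
  \<open>v\<close> and normalise \<open>v - b\<close>.\<close>

lemma riesz_separation:
  fixes B :: "'b::real_normed_vector set"
  assumes "infinite_dimensional TYPE('b)" "finite B"
  shows "\<exists>x. norm x \<le> 1 \<and> (\<forall>b\<in>B. 1 / 2 \<le> norm (x - b))"
proof -
  obtain v where v: "v \<notin> span B" using assms by (auto simp: infinite_dimensional_def)
  define d where "d = infdist v (span B)"
  have ne: "span B \<noteq> {}" using span_zero by blast
  have d: "0 < d"
    using v closed_span_finite[OF assms(2)] ne infdist_pos_not_in_closed unfolding d_def by blast
  have "infdist v (span B) < 2 * d" using d by (simp add: d_def)
  then obtain b where b: "b \<in> span B" "dist v b < 2 * d"
    using cInf_lessD[of "dist v ` span B" "2 * d"] ne by (auto simp: infdist_notempty[OF ne])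
  define r where "r = norm (v - b)"
  have r: "0 < r" "r < 2 * d" using b v by (auto simp: r_def dist_norm)
  have "1 / 2 \<le> norm ((1 / r) *\<^sub>R (v - b) - c)" if "c \<in> B" for c
  proof -
    have "b + r *\<^sub>R c \<in> span B" by (rule span_add[OF b(1) span_scale[OF span_base[OF that]]])
    then have "d \<le> dist v (b + r *\<^sub>R c)" unfolding d_def by (rule infdist_le)
    also have "\<dots> = norm (r *\<^sub>R ((1 / r) *\<^sub>R (v - b) - c))"
      using r by (simp add: dist_norm algebra_simps)
    also have "\<dots> = r * norm ((1 / r) *\<^sub>R (v - b) - c)" using r by simp
    finally have "d \<le> r * norm ((1 / r) *\<^sub>R (v - b) - c)" .
    moreover have "r * norm ((1 / r) *\<^sub>R (v - b) - c) \<le> 2 * d * norm ((1 / r) *\<^sub>R (v - b) - c)"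
      using r by (intro mult_right_mono) auto
    ultimately have "d * 1 \<le> d * (2 * norm ((1 / r) *\<^sub>R (v - b) - c))" by simp
    then have "1 \<le> 2 * norm ((1 / r) *\<^sub>R (v - b) - c)" using d by (simp only: mult_le_cancel_left_pos)
    then show ?thesis by simp
  qed
  moreover have "norm ((1 / r) *\<^sub>R (v - b)) \<le> 1" using r by (simp add: r_def)
  ultimately show ?thesis by blast
qed

lemma separated_sequence:
  assumes "infinite_dimensional TYPE('b::real_normed_vector)"
  shows "\<exists>x :: nat \<Rightarrow> 'b. (\<forall>k. norm (x k) \<le> 1) \<and> (\<forall>k l. k < l \<longrightarrow> 1 / 2 \<le> norm (x k - x l))"
proof -
  obtain pick :: "'b set \<Rightarrow> 'b"
    where pick: "\<And>B. finite B \<Longrightarrow> norm (pick B) \<le> 1 \<and> (\<forall>b\<in>B. 1 / 2 \<le> norm (pick B - b))"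
    using riesz_separation[OF assms] by metis
  define S where "S n = ((\<lambda>B. insert (pick B) B) ^^ n) {}" for n :: nat
  have S: "S 0 = {}" "S (Suc n) = insert (pick (S n)) (S n)" for n by (simp_all add: S_def)
  have fin: "finite (S n)" for n by (induction n) (simp_all add: S)
  have mem: "pick (S k) \<in> S l" if "k < l" for k l
    using that by (induction l) (auto simp: S less_Suc_eq)
  have "1 / 2 \<le> norm (pick (S k) - pick (S l))" if "k < l" for k l
    using pick[OF fin[of l]] mem[OF that] norm_minus_commute[of "pick (S k)" "pick (S l)"] by simp
  moreover have "norm (pick (S k)) \<le> 1" for k using pick[OF fin] by blast
  ultimately show ?thesis by (intro exI[of _ "\<lambda>n. pick (S n)"]) simp
qed

text \<open>
  Limits along an ultrafilter always exist, and a zero coefficient leaves the iterated limit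
  unchanged; so no appeal to Ramsey's theorem is needed to get a spreading norm.
\<close>

primrec iterated_lim ::
    "nat filter \<Rightarrow> (nat \<Rightarrow> 'b::real_normed_vector) \<Rightarrow> real list \<Rightarrow> 'b \<Rightarrow> real"
  where "iterated_lim U x [] y = norm y"
  | "iterated_lim U x (a # as) y = Lim U (\<lambda>k. iterated_lim U x as (y + a *\<^sub>R x k))"

context
  fixes U :: "nat filter" and x :: "nat \<Rightarrow> 'b::real_normed_vector"
  assumes U: "ultra U" and norm_x: "\<And>k. norm (x k) \<le> 1"
begin

lemma ultra_ne_bot: "U \<noteq> bot"
  using U by (simp add: ultra_def)

lemma iterated_lim_bounds:
  "0 \<le> iterated_lim U x as y \<and> iterated_lim U x as y \<le> norm y + (\<Sum>a\<leftarrow>as. \<bar>a\<bar>)"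
proof (induction as arbitrary: y)
  case (Cons a as)
  have le: "iterated_lim U x as (y + a *\<^sub>R x k) \<le> norm y + (\<bar>a\<bar> + (\<Sum>a\<leftarrow>as. \<bar>a\<bar>))" for k
  proof -
    have "norm (y + a *\<^sub>R x k) \<le> norm y + \<bar>a\<bar> * 1"
      using norm_x[of k] by (intro norm_triangle_le add_left_mono) (simp add: mult_left_le)
    then show ?thesis using Cons[of "y + a *\<^sub>R x k"] by simp
  qed
  have lim: "((\<lambda>k. iterated_lim U x as (y + a *\<^sub>R x k)) \<longlongrightarrow> iterated_lim U x (a # as) y) U"
    unfolding iterated_lim.simps using Cons le
    by (intro ultra_tendsto[OF U, of _ "norm y + (\<bar>a\<bar> + (\<Sum>a\<leftarrow>as. \<bar>a\<bar>))"]) auto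
  have "0 \<le> iterated_lim U x (a # as) y"
    by (rule tendsto_lowerbound[OF lim always_eventually ultra_ne_bot]) (simp add: Cons)
  moreover have "iterated_lim U x (a # as) y \<le> norm y + (\<bar>a\<bar> + (\<Sum>a\<leftarrow>as. \<bar>a\<bar>))"
    by (rule tendsto_upperbound[OF lim always_eventually ultra_ne_bot]) (rule allI, rule le)
  ultimately show ?case by simp
qed simp

lemma iterated_lim_tendsto:
  "((\<lambda>k. iterated_lim U x as (y + a *\<^sub>R x k)) \<longlongrightarrow> iterated_lim U x (a # as) y) U"
proof -
  have "iterated_lim U x as (y + a *\<^sub>R x k) \<le> norm y + (\<bar>a\<bar> + (\<Sum>a\<leftarrow>as. \<bar>a\<bar>))" for k
  proof -
    have "norm (y + a *\<^sub>R x k) \<le> norm y + \<bar>a\<bar> * 1"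
      using norm_x[of k] by (intro norm_triangle_le add_left_mono) (simp add: mult_left_le)
    then show ?thesis using iterated_lim_bounds[of as "y + a *\<^sub>R x k"] by simp
  qed
  then show ?thesis
    unfolding iterated_lim.simps using iterated_lim_bounds
    by (intro ultra_tendsto[OF U, of _ "norm y + (\<bar>a\<bar> + (\<Sum>a\<leftarrow>as. \<bar>a\<bar>))"]) auto
qed

lemma iterated_lim_add:
  "length as = length bs \<Longrightarrow>
    iterated_lim U x (map2 (+) as bs) (y + z) \<le> iterated_lim U x as y + iterated_lim U x bs z"
proof (induction as bs arbitrary: y z rule: list_induct2)
  case (Cons a as b bs)
  have "iterated_lim U x (map2 (+) as bs) ((y + z) + (a + b) *\<^sub>R x k)
      \<le> iterated_lim U x as (y + a *\<^sub>R x k) + iterated_lim U x bs (z + b *\<^sub>R x k)" for k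
    using Cons.IH[of "y + a *\<^sub>R x k" "z + b *\<^sub>R x k"] by (simp add: algebra_simps)
  then have "iterated_lim U x ((a + b) # map2 (+) as bs) (y + z)
      \<le> iterated_lim U x (a # as) y + iterated_lim U x (b # bs) z"
    by (intro tendsto_le[OF ultra_ne_bot tendsto_add[OF iterated_lim_tendsto iterated_lim_tendsto]
          iterated_lim_tendsto] always_eventually) simp
  then show ?case by simp
qed (simp add: norm_triangle_ineq)

lemma iterated_lim_scale:
  "iterated_lim U x (map ((*) r) as) (r *\<^sub>R y) = \<bar>r\<bar> * iterated_lim U x as y"
proof (induction as arbitrary: y)
  case (Cons a as)
  have "iterated_lim U x (map ((*) r) as) (r *\<^sub>R y + (r * a) *\<^sub>R x k)
      = \<bar>r\<bar> * iterated_lim U x as (y + a *\<^sub>R x k)" for k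
    using Cons[of "y + a *\<^sub>R x k"] by (simp add: scaleR_add_right)
  then have "((\<lambda>k. iterated_lim U x (map ((*) r) as) (r *\<^sub>R y + (r * a) *\<^sub>R x k))
      \<longlongrightarrow> \<bar>r\<bar> * iterated_lim U x (a # as) y) U"
    using tendsto_mult_left[OF iterated_lim_tendsto] by simp
  then show ?case using tendsto_unique[OF ultra_ne_bot iterated_lim_tendsto] by simp
qed simp

lemma iterated_lim_insert_zero:
  "iterated_lim U x (as @ 0 # bs) y = iterated_lim U x (as @ bs) y"
proof (induction as arbitrary: y)
  case Nil
  then show ?case using ultra_ne_bot by (simp add: tendsto_Lim)
qed simp

lemma list_norm_iterated_lim: "list_norm (\<lambda>as. iterated_lim U x as 0)"
proof
  fix a b :: "real list" and r
  show "length a = length b \<Longrightarrow>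
      iterated_lim U x (map2 (+) a b) 0 \<le> iterated_lim U x a 0 + iterated_lim U x b 0"
    using iterated_lim_add[of a b 0 0] by simp
  show "iterated_lim U x (map ((*) r) a) 0 = \<bar>r\<bar> * iterated_lim U x a 0"
    using iterated_lim_scale[of r a 0] by simp
qed (rule iterated_lim_insert_zero)

text \<open>Vectors are chosen from the outermost limit inwards, one index \<open>k\<close> serving
  all of the finite set \<open>F\<close>. The summand just fixed depends on the list, which is why
  each list carries its own base point \<open>y\<close>.\<close>

lemma iterated_lim_approx:
  assumes "finite F" "\<forall>(c, y)\<in>F. length c = m" "0 < \<epsilon>"
  shows "\<exists>ys. length ys = m \<and> (\<forall>(c, y)\<in>F. \<bar>iterated_lim U x c y - norm (y + lincomb c ys)\<bar> < \<epsilon>)"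
  using assms
proof (induction m arbitrary: F \<epsilon>)
  case 0
  then show ?case by (intro exI[of _ "[]"]) auto
next
  case (Suc m)
  let ?shift = "\<lambda>k (c, y). (tl c, y + hd c *\<^sub>R x k)"
  let ?near = "\<lambda>k (c, y). \<bar>iterated_lim U x (tl c) (y + hd c *\<^sub>R x k) - iterated_lim U x c y\<bar> < \<epsilon> / 2"
  have ne: "fst p \<noteq> []" if "p \<in> F" for p using Suc.prems(2) that by (cases "fst p") auto
  have "\<forall>p\<in>F. eventually (\<lambda>k. ?near k p) U"
  proof
    fix p assume p: "p \<in> F"
    obtain a c y where "p = (a # c, y)" using ne[OF p] by (metis list.exhaust prod.collapse)
    then show "eventually (\<lambda>k. ?near k p) U"
      using tendstoD[OF iterated_lim_tendsto, of "\<epsilon> / 2" c y a] Suc.prems(3)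
      by (simp add: dist_real_def)
  qed
  then have "eventually (\<lambda>k. \<forall>p\<in>F. ?near k p) U"
    using Suc.prems by (intro eventually_ball_finite) auto
  then obtain k where k: "\<forall>p\<in>F. ?near k p" using ultra_ne_bot eventually_happens' by blast
  have "finite (?shift k ` F)" "\<forall>(c, y)\<in>?shift k ` F. length c = m" "0 < \<epsilon> / 2"
    using Suc.prems by auto
  from Suc.IH[OF this] obtain ys where ys: "length ys = m"
    "\<forall>(c, y)\<in>?shift k ` F. \<bar>iterated_lim U x c y - norm (y + lincomb c ys)\<bar> < \<epsilon> / 2"
    by blast
  have "\<bar>iterated_lim U x c y - norm (y + lincomb c (x k # ys))\<bar> < \<epsilon>" if p: "(c, y) \<in> F" for c y
  proof -
    obtain a d where c: "c = a # d" using ne[OF p] by (cases c) auto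
    have "\<bar>iterated_lim U x d (y + a *\<^sub>R x k) - iterated_lim U x c y\<bar> < \<epsilon> / 2"
      using k[rule_format, OF p] c by simp
    moreover have "(d, y + a *\<^sub>R x k) \<in> ?shift k ` F" using p c by force
    then have "\<bar>iterated_lim U x d (y + a *\<^sub>R x k) - norm (y + a *\<^sub>R x k + lincomb d ys)\<bar> < \<epsilon> / 2"
      using ys(2) by blast
    ultimately have "\<bar>iterated_lim U x c y - norm (y + a *\<^sub>R x k + lincomb d ys)\<bar> < \<epsilon>" by linarith
    then show ?thesis by (simp add: c add.assoc)
  qed
  then show ?case using ys(1) by (intro exI[of _ "x k # ys"]) auto
qed

lemma fin_rep_iterated_lim: "fin_rep TYPE('b) (\<lambda>as. iterated_lim U x as 0)"
  unfolding fin_rep_def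
proof (intro allI impI)
  fix m and F :: "real list set" and \<epsilon> :: real
  assume "finite F" "\<forall>c\<in>F. length c = m" "0 < \<epsilon>"
  then have "\<exists>ys. length ys = m \<and>
      (\<forall>(c, y)\<in>F \<times> {0}. \<bar>iterated_lim U x c y - norm (y + lincomb c ys)\<bar> < \<epsilon>)"
    by (intro iterated_lim_approx) auto
  then show "\<exists>ys :: 'b list. length ys = m \<and>
      (\<forall>c\<in>F. \<bar>iterated_lim U x c 0 - norm (lincomb c ys)\<bar> < \<epsilon>)"
    by auto
qed

text \<open>Since \<open>U\<close> refines \<open>sequentially\<close>, the inner index eventually
  exceeds the fixed outer one. With \<open>\<delta> > 0\<close> this keeps the limit from
  degenerating on differences.\<close>

lemma iterated_lim_difference:
  assumes "U \<le> sequentially" and sep: "\<And>k l. k < l \<Longrightarrow> \<delta> \<le> norm (x k - x l)"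
  shows "\<delta> \<le> iterated_lim U x [1, - 1] 0"
proof -
  have "\<delta> \<le> iterated_lim U x [- 1] (0 + 1 *\<^sub>R x k)" for k
  proof (rule tendsto_lowerbound[OF iterated_lim_tendsto _ ultra_ne_bot])
    show "\<forall>\<^sub>F l in U. \<delta> \<le> iterated_lim U x [] (0 + 1 *\<^sub>R x k + - 1 *\<^sub>R x l)"
      using filter_leD[OF assms(1) eventually_gt_at_top[of k]]
      by eventually_elim (simp add: sep)
  qed
  then show ?thesis
    by (intro tendsto_lowerbound[OF iterated_lim_tendsto _ ultra_ne_bot] always_eventually) blast
qed

end

subsection \<open>Embedding nearly equilateral metrics\<close>

definition near_equilateral_embeds :: "'b::real_normed_vector itself \<Rightarrow> 'a set \<Rightarrow> bool"
  where "near_equilateral_embeds _ X \<longleftrightarrow> (\<exists>r1 r2. 0 < r1 \<and> r1 < r2 \<and>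
    (\<forall>\<rho>. (\<forall>x\<in>X. \<forall>y\<in>X. x \<noteq> y \<longrightarrow> \<rho> x y = \<rho> y x \<and> r1 \<le> \<rho> x y \<and> \<rho> x y \<le> r2) \<longrightarrow>
      (\<exists>f :: 'a \<Rightarrow> 'b. \<forall>x\<in>X. \<forall>y\<in>X. x \<noteq> y \<longrightarrow> dist (f x) (f y) = \<rho> x y)))"

text \<open>The Poincare-Miranda theorem is applied with one equation for each two-element subset
  \<open>A\<close> of \<open>X\<close>, whose own parameter is \<open>t A\<close>. The coefficients
  are bounded, so the approximation in the normed space is uniform in \<open>t\<close> and keeps the
  signs on opposite faces.\<close>

lemma near_equilateral_embedsI:
  fixes X :: "'a set" and v :: "('a set \<Rightarrow> real) \<Rightarrow> 'a \<Rightarrow> 'c \<Rightarrow> real"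
  defines "S \<equiv> {t. \<forall>A. 0 \<le> t A \<and> t A \<le> 1}"
  assumes P: "list_norm P" "fin_rep TYPE('b::real_normed_vector) P" and X: "finite X"
    and cont: "\<And>x s. continuous_on S (\<lambda>t. v t x s)"
    and bd: "\<And>t x s. t \<in> S \<Longrightarrow> \<bar>v t x s\<bar> \<le> B"
    and lohi: "0 \<le> lo" "lo < hi"
    and lo: "\<And>t x y. t \<in> S \<Longrightarrow> x \<in> X \<Longrightarrow> y \<in> X \<Longrightarrow> x \<noteq> y \<Longrightarrow> t {x, y} = 0 \<Longrightarrow>
      P (map (\<lambda>s. v t x s - v t y s) sl) \<le> lo"
    and hi: "\<And>t x y. t \<in> S \<Longrightarrow> x \<in> X \<Longrightarrow> y \<in> X \<Longrightarrow> x \<noteq> y \<Longrightarrow> t {x, y} = 1 \<Longrightarrow>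
      hi \<le> P (map (\<lambda>s. v t x s - v t y s) sl)"
  shows "near_equilateral_embeds TYPE('b) X"
proof -
  \<comment> \<open>The approximation costs \<open>\<epsilon>\<close> at either end; the interval
    from \<open>lo + \<epsilon>\<close> to \<open>hi - \<epsilon>\<close> remains.\<close>
  define \<epsilon> where "\<epsilon> = (hi - lo) / 4"
  have \<epsilon>: "0 < \<epsilon>" using lohi by (simp add: \<epsilon>_def)
  obtain ys :: "'b list" where approx: "\<And>c. length c = length sl \<Longrightarrow> (\<forall>x\<in>set c. \<bar>x\<bar> \<le> 2 * B) \<Longrightarrow>
      \<bar>P c - norm (lincomb c ys)\<bar> \<le> \<epsilon>"
    using fin_rep_box[OF P \<epsilon>] by blast
  define p where "p t x = lincomb (map (v t x) sl) ys" for t x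
  have near: "\<bar>P (map (\<lambda>s. v t x s - v t y s) sl) - dist (p t x) (p t y)\<bar> \<le> \<epsilon>" if t: "t \<in> S" for t x y
  proof -
    have "\<bar>v t x s - v t y s\<bar> \<le> 2 * B" for s using bd[OF t, of x s] bd[OF t, of y s] by linarith
    then show ?thesis
      using approx[of "map (\<lambda>s. v t x s - v t y s) sl"] by (simp add: p_def dist_norm lincomb_map_diff)
  qed
  define I where "I = {A. A \<subseteq> X \<and> card A = 2}"
  have "finite I" using X by (simp add: I_def)
  have "\<forall>A\<in>I. \<exists>x y. {x, y} = A \<and> x \<noteq> y" by (auto simp: I_def card_2_iff)
  then obtain e1 e2 where e: "\<And>A. A \<in> I \<Longrightarrow> {e1 A, e2 A} = A \<and> e1 A \<noteq> e2 A" by metis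
  have eX: "e1 A \<in> X" "e2 A \<in> X" if "A \<in> I" for A using e[OF that] that by (auto simp: I_def)
  have "\<exists>f :: 'a \<Rightarrow> 'b. \<forall>x\<in>X. \<forall>y\<in>X. x \<noteq> y \<longrightarrow> dist (f x) (f y) = \<rho> x y"
    if \<rho>: "\<forall>x\<in>X. \<forall>y\<in>X. x \<noteq> y \<longrightarrow> \<rho> x y = \<rho> y x \<and> lo + \<epsilon> \<le> \<rho> x y \<and> \<rho> x y \<le> hi - \<epsilon>" for \<rho>
  proof -
    have "\<exists>t\<in>S. \<forall>A\<in>I. dist (p t (e1 A)) (p t (e2 A)) - \<rho> (e1 A) (e2 A) = 0"
      unfolding S_def
    proof (rule poincare_miranda[OF \<open>finite I\<close>], fold S_def)
      show "continuous_on S (\<lambda>t. dist (p t (e1 A)) (p t (e2 A)) - \<rho> (e1 A) (e2 A))" for A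
        unfolding p_def by (intro continuous_intros continuous_on_lincomb cont)
      fix t A assume t: "t \<in> S" and A: "A \<in> I"
      note b = \<rho>[rule_format, OF eX[OF A]] and A' = e[OF A]
      show "dist (p t (e1 A)) (p t (e2 A)) - \<rho> (e1 A) (e2 A) \<le> 0" if "t A = 0"
        using lo[OF t eX[OF A]] near[OF t, of "e1 A" "e2 A"] b A' that by fastforce
      show "0 \<le> dist (p t (e1 A)) (p t (e2 A)) - \<rho> (e1 A) (e2 A)" if "t A = 1"
        using hi[OF t eX[OF A]] near[OF t, of "e1 A" "e2 A"] b A' that by fastforce
    qed
    then obtain t where t: "\<And>A. A \<in> I \<Longrightarrow> dist (p t (e1 A)) (p t (e2 A)) = \<rho> (e1 A) (e2 A)" by auto
    have "dist (p t x) (p t y) = \<rho> x y" if xy: "x \<in> X" "y \<in> X" "x \<noteq> y" for x y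
    proof -
      have "{x, y} \<in> I" using xy by (simp add: I_def)
      note A = t[OF this] e[OF this]
      then have "e1 {x, y} = x \<and> e2 {x, y} = y \<or> e1 {x, y} = y \<and> e2 {x, y} = x"
        by (simp add: doubleton_eq_iff)
      then show ?thesis
        using A(1) \<rho>[rule_format, OF xy] dist_commute[of "p t x" "p t y"] by auto
    qed
    then show ?thesis by blast
  qed
  moreover have "0 < lo + \<epsilon>" "lo + \<epsilon> < hi - \<epsilon>" using \<epsilon> lohi by (auto simp: \<epsilon>_def field_simps)
  ultimately show ?thesis unfolding near_equilateral_embeds_def by blast
qed

section \<open>Bounded sums of basis vectors\<close>

context list_norm
begin

lemma entry_convex:
  assumes "0 \<le> p" "0 \<le> q" "p + q = 1"
  shows "P (a @ (p * x + q * y) # b) \<le> p * P (a @ x # b) + q * P (a @ y # b)"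
proof -
  have split: "map2 (+) (map ((*) p) c) (map ((*) q) c) = c" for c
    using assms(3) by (induction c) (simp_all flip: distrib_right)
  have "P (a @ (p * x + q * y) # b) =
      P (map2 (+) (map ((*) p) (a @ x # b)) (map ((*) q) (a @ y # b)))"
    by (simp add: split)
  also have "\<dots> \<le> P (map ((*) p) (a @ x # b)) + P (map ((*) q) (a @ y # b))"
    by (rule add_le) simp
  finally show ?thesis using assms unfolding scale by simp
qed

text \<open>A convex function on the interval from \<open>- y\<close> to \<open>y\<close> is bounded
  by its values at the ends.\<close>

lemma entry_le_extreme:
  assumes "\<bar>x\<bar> \<le> y" "P (a @ y # b) \<le> C" "P (a @ - y # b) \<le> C"
  shows "P (a @ x # b) \<le> C"
proof (cases "y = 0")
  case False
  define p where "p = (1 + x / y) / 2"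
  have l: "0 \<le> p" "0 \<le> 1 - p" "p + (1 - p) = 1"
    using assms(1) False by (auto simp: p_def field_simps)
  have "p * y + (1 - p) * (- y) = x" using False by (simp add: p_def field_simps)
  then have "P (a @ x # b) \<le> p * P (a @ y # b) + (1 - p) * P (a @ - y # b)"
    using entry_convex[OF l, of a y "- y" b] by simp
  also have "\<dots> \<le> p * C + (1 - p) * C"
    using assms l by (intro add_mono mult_left_mono) auto
  also have "\<dots> = C" by (simp add: algebra_simps)
  finally show ?thesis .
qed (use assms in auto)

lemma indicator:
  "P (map (\<lambda>s. if Q s then 1 else 0) sl) = P (replicate (length (filter Q sl)) 1)"
proof -
  have "filter (\<lambda>x. x \<noteq> 0) (map (\<lambda>s. if Q s then 1 else 0) sl) = replicate (length (filter Q sl)) (1::real)"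
    by (induction sl) simp_all
  then show ?thesis using filter_nonzero[of "[]" "map (\<lambda>s. if Q s then 1 else 0) sl"] by simp
qed

end

lemma continuous_on_coordinate: "continuous_on S (\<lambda>t :: 'i \<Rightarrow> 'c::topological_space. t i)"
  by (rule continuous_on_subset[OF continuous_on_product_coordinates]) simp

lemma abs_in_block:
  "x \<in> set (block w c) \<Longrightarrow> set w \<subseteq> {1, - 1} \<Longrightarrow> \<exists>y\<in>set c. \<bar>x\<bar> = \<bar>y\<bar>"
  by (induction c) auto

text \<open>
  James' distortion argument: if the sums of basis vectors are bounded, then copies of a word \<open>w\<close> of
  signs that almost attains the supremum are almost isometrically the basis of \<open>c\<^sub>0\<close>.
\<close>

lemma near_equilateral_embeds_bounded:
  fixes X :: "'a set"
  assumes P: "list_norm P" and rep: "fin_rep TYPE('b::real_normed_vector) P"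
    and drop: "\<And>a x b. P (a @ b) \<le> P (a @ x # b)"
    and pos: "0 < P [1]" and C: "\<And>m. P (replicate m 1) \<le> C" and X: "finite X"
  shows "near_equilateral_embeds TYPE('b) X"
proof -
  interpret list_norm P by fact
  have drop_list: "P (a @ b) \<le> P (a @ d @ b)" for a d b
  proof (induction d)
    case (Cons x d)
    then show ?case using drop[of a "d @ b" x] by simp
  qed simp
  define W :: "real list set" where "W = {w. set w \<subseteq> {1, - 1}}"
  \<comment> \<open>Positive and negative signs are separated; either part is a sum of basis vectors
    once its zeros are dropped.\<close>
  have W_le: "P w \<le> 2 * C" if "w \<in> W" for w
  proof -
    have "map (\<lambda>x. (if x = 1 then 1 else 0) - (if x = - 1 then 1 else 0)) w = w"
      using that by (intro map_idI) (auto simp: W_def)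
    then have "P w \<le> P (map (\<lambda>x. if x = 1 then 1 else 0) w) + P (map (\<lambda>x. if x = - 1 then 1 else 0) w)"
      using map_diff_le[of "\<lambda>x. if x = 1 then 1 else 0" "\<lambda>x. if x = - 1 then 1 else 0" w] by simp
    also have "\<dots> \<le> C + C" unfolding indicator by (intro add_mono C)
    finally show ?thesis by simp
  qed
  define \<Lambda> where "\<Lambda> = Sup (P ` W)"
  have "bdd_above (P ` W)" using W_le by (auto intro!: bdd_aboveI2[of _ _ "2 * C"])
  then have le_\<Lambda>: "P w \<le> \<Lambda>" if "w \<in> W" for w
    unfolding \<Lambda>_def using that by (auto intro: cSup_upper)
  have "[1] \<in> W" by (simp add: W_def)
  then have \<Lambda>: "0 < \<Lambda>" using le_\<Lambda>[of "[1]"] pos by simp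
  \<comment> \<open>The configuration below has sup distances 8 and 10 at the extreme parameters.
    The factor \<open>9 / 10\<close> turns 10 into the lower bound \<open>9 * \<Lambda>\<close>,
    still above the upper bound \<open>8 * \<Lambda>\<close> for 8.\<close>
  have "W \<noteq> {}" "9 / 10 * \<Lambda> < Sup (P ` W)" using \<Lambda> \<open>[1] \<in> W\<close> by (auto simp flip: \<Lambda>_def)
  then obtain w where w: "w \<in> W" "9 / 10 * \<Lambda> < P w"
    using less_cSupD[of "P ` W"] by blast
  \<comment> \<open>Entries are pushed to 1 or - 1 one after another, with \<open>a\<close>
    collecting those already done; the vertices of the cube are words in \<open>W\<close>.\<close>
  have cube: "P (a @ c) \<le> \<Lambda>" if "a \<in> W" "\<forall>x\<in>set c. \<bar>x\<bar> \<le> 1" for a c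
    using that
  proof (induction c arbitrary: a)
    case (Cons x c)
    then show ?case
      using Cons.IH[of "a @ [1]"] Cons.IH[of "a @ [- 1]"]
      by (intro entry_le_extreme[of x 1]) (auto simp: W_def)
  qed (simp add: le_\<Lambda>)
  have upper: "P (block w c) \<le> M * \<Lambda>" if c: "\<forall>x\<in>set c. \<bar>x\<bar> \<le> M" and M: "0 < M" for c M
  proof -
    let ?c = "map ((*) (1 / M)) c"
    have "\<bar>x\<bar> \<le> 1" if x: "x \<in> set (block w ?c)" for x
      using abs_in_block[OF x] w(1) c M by (force simp: W_def abs_mult)
    then have "P (block w ?c) \<le> \<Lambda>" using cube[of "[]"] by (simp add: W_def)
    moreover have "map ((*) M) ?c = c" using M by (simp add: o_def)
    then have "P (block w c) = M * P (block w ?c)"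
      using scale[of M "block w ?c"] M by (simp flip: block_scale)
    ultimately show ?thesis using M by simp
  qed
  have lower: "\<bar>x\<bar> * P w \<le> P (block w c)" if x: "x \<in> set c" for x c
  proof -
    obtain a b where c: "c = a @ x # b" using split_list[OF x] by blast
    have "\<bar>x\<bar> * P w = P (map ((*) x) w)" by (simp add: scale)
    also have "\<dots> \<le> P (map ((*) x) w @ block w b)"
      using drop_list[of "map ((*) x) w" "[]" "block w b"] by simp
    also have "\<dots> \<le> P (block w c)"
      using drop_list[of "[]" "map ((*) x) w @ block w b" "block w a"] by (simp add: c)
    finally show ?thesis .
  qed
  have "finite {(a, b). a \<in> X \<and> b \<in> X \<and> a \<noteq> b}"
    by (rule finite_subset[of _ "X \<times> X"]) (use X in auto)
  then obtain sl where sl: "set sl = {(a, b). a \<in> X \<and> b \<in> X \<and> a \<noteq> b}"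
    using finite_list by blast
  \<comment> \<open>In the coordinates \<open>(x, y)\<close> and \<open>(y, x)\<close> the points
    \<open>x\<close> and \<open>y\<close> differ by \<open>8 + 2 * t {x, y}\<close> in absolute
    value. In any other coordinate one of the two points is 0, so they differ by at most 5.\<close>
  define v :: "('a set \<Rightarrow> real) \<Rightarrow> 'a \<Rightarrow> 'a \<times> 'a \<Rightarrow> real"
    where "v t x = (\<lambda>(a, b). if x = a then 4 + t {a, b} else if x = b then - (4 + t {a, b}) else 0)"
      for t x
  show ?thesis
  proof (rule near_equilateral_embedsI[where v = v and sl = sl and lo = "8 * \<Lambda>" and hi = "9 * \<Lambda>" and B = 5])
    show "list_norm (\<lambda>c. P (block w c))" "fin_rep TYPE('b) (\<lambda>c. P (block w c))"
      by (rule list_norm_block[OF P] fin_rep_block[OF rep])+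
    show "continuous_on {t. \<forall>A. 0 \<le> t A \<and> t A \<le> 1} (\<lambda>t. v t x s)" for x s
      by (cases s; cases "x = fst s"; cases "x = snd s")
        (auto simp: v_def intro!: continuous_intros continuous_on_coordinate)
    show "\<bar>v t x s\<bar> \<le> 5" if "t \<in> {t. \<forall>A. 0 \<le> t A \<and> t A \<le> 1}" for t x s
    proof (cases s)
      case (Pair a b)
      have "0 \<le> t {a, b}" "t {a, b} \<le> 1" using that by auto
      then show ?thesis by (simp add: v_def Pair abs_le_iff)
    qed
    fix t :: "'a set \<Rightarrow> real" and x y
    assume t: "t \<in> {t. \<forall>A. 0 \<le> t A \<and> t A \<le> 1}" and xy: "x \<in> X" "y \<in> X" "x \<noteq> y"
    show "P (block w (map (\<lambda>s. v t x s - v t y s) sl)) \<le> 8 * \<Lambda>" if t0: "t {x, y} = 0"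
    proof -
      have "\<bar>v t x s - v t y s\<bar> \<le> 8" for s
      proof (cases s)
        case (Pair a b)
        have "0 \<le> t {a, b}" "t {a, b} \<le> 1" "t {y, x} = 0" using t t0 by (auto simp: insert_commute)
        then show ?thesis using t0 xy by (auto simp: v_def Pair abs_le_iff)
      qed
      then show ?thesis by (intro upper) auto
    qed
    show "9 * \<Lambda> \<le> P (block w (map (\<lambda>s. v t x s - v t y s) sl))" if t1: "t {x, y} = 1"
    proof -
      have "10 \<in> set (map (\<lambda>s. v t x s - v t y s) sl)"
        using xy t1 by (auto simp: v_def sl intro!: image_eqI[of _ _ "(x, y)"])
      from lower[OF this] show ?thesis using w(2) by simp
    qed
  qed (use X \<Lambda> in auto)
qed

section \<open>Spreading norms invariant under changes of signs\<close>

locale sign_list_norm = list_norm +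
  assumes flip_sign: "P (a @ - x # b) = P (a @ x # b)"
begin

text \<open>In each entry \<open>P\<close> is convex and even, hence increasing in the absolute
  value.\<close>

lemma mono_entry: "\<bar>x\<bar> \<le> \<bar>y\<bar> \<Longrightarrow> P (a @ x # b) \<le> P (a @ y # b)"
  by (rule entry_le_extreme[of x "\<bar>y\<bar>"]) (auto simp: flip_sign abs_if)

lemma drop_entry: "P (a @ b) \<le> P (a @ x # b)"
  using mono_entry[of 0 x a b] by (simp add: insert_zero)

lemma mono_map:
  assumes "\<forall>s\<in>set sl. \<bar>f s\<bar> \<le> \<bar>g s\<bar>"
  shows "P (map f sl) \<le> P (map g sl)"
proof -
  have "P (a @ map f sl) \<le> P (a @ map g sl)" for a
    using assms
  proof (induction sl arbitrary: a)
    case (Cons s sl)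
    have "P (a @ f s # map f sl) \<le> P (a @ g s # map f sl)" using Cons.prems by (intro mono_entry) simp
    also have "\<dots> \<le> P (a @ g s # map g sl)" using Cons.IH[of "a @ [g s]"] Cons.prems by simp
    finally show ?case by simp
  qed simp
  from this[of "[]"] show ?thesis by simp
qed

lemma mono_replicate: "i \<le> j \<Longrightarrow> P (replicate i 1) \<le> P (replicate j 1)"
  using lift_Suc_mono_le[of "\<lambda>m. P (replicate m 1)"] drop_entry[of "[]" _ 1] by simp

lemma indicator_card:
  "distinct sl \<Longrightarrow> P (map (\<lambda>s. if Q s then 1 else 0) sl) = P (replicate (card {s \<in> set sl. Q s}) 1)"
  unfolding indicator using distinct_card[of "filter Q sl"] by simp

lemma map_le_replicate:
  assumes "distinct sl" "\<And>s. s \<in> set sl \<Longrightarrow> \<bar>f s\<bar> \<le> 1" "card {s \<in> set sl. f s \<noteq> 0} \<le> k"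
  shows "P (map f sl) \<le> P (replicate k 1)"
proof -
  have "P (map f sl) \<le> P (map (\<lambda>s. if f s \<noteq> 0 then 1 else 0) sl)"
    using assms(2) by (intro mono_map) auto
  also have "\<dots> \<le> P (replicate k 1)"
    unfolding indicator_card[OF assms(1)] by (rule mono_replicate) fact
  finally show ?thesis .
qed

lemma replicate_le_map:
  assumes "distinct sl" "A \<subseteq> set sl" "\<And>s. s \<in> A \<Longrightarrow> 1 \<le> \<bar>f s\<bar>" "k \<le> card A"
  shows "P (replicate k 1) \<le> P (map f sl)"
proof -
  have "{s \<in> set sl. s \<in> A} = A" using assms(2) by auto
  then have "P (replicate k 1) \<le> P (map (\<lambda>s. if s \<in> A then 1 else 0) sl)"
    unfolding indicator_card[OF assms(1)] using assms(4) by (simp add: mono_replicate)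
  also have "\<dots> \<le> P (map f sl)" using assms(3) by (intro mono_map) auto
  finally show ?thesis .
qed

end

text \<open>\<open>Private y z l\<close> takes over for \<open>y\<close> the part of unit
  \<open>l\<close> of the pair \<open>{y, z}\<close> that is not in \<open>Shared {y, z} l\<close>.
  The \<open>Own\<close> slots enlarge all symmetric differences by the same amount.\<close>

datatype 'a slot = Shared "'a set" nat | Private 'a 'a nat | Own 'a nat

text \<open>
  The first \<open>\<lfloor>\<sigma>\<rfloor>\<close> of the units \<open>0, 1, \<dots>\<close> have weight \<open>1\<close>, the next one has the fractional part of
  \<open>\<sigma>\<close>, and the others have weight \<open>0\<close>.
\<close>

definition weight :: "real \<Rightarrow> nat \<Rightarrow> real"
  where "weight \<sigma> l = max 0 (min 1 (\<sigma> - real l))"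

lemma weight_bounds: "0 \<le> weight \<sigma> l" "weight \<sigma> l \<le> 1"
  by (auto simp: weight_def)

lemma weight_eq_1: "l < nat \<lfloor>\<sigma>\<rfloor> \<Longrightarrow> weight \<sigma> l = 1"
  unfolding weight_def by linarith

lemma weight_eq_0: "nat \<lfloor>\<sigma>\<rfloor> < l \<Longrightarrow> weight \<sigma> l = 0"
  unfolding weight_def by linarith

text \<open>
  The point \<open>x\<close> is the indicator of a set of slots. For a pair \<open>A\<close> containing \<open>x\<close>, it has \<open>L\<close> units,
  of which \<open>\<sigma> A\<close> are shared by the two points of \<open>A\<close>.
\<close>

definition slot_point :: "('a set \<Rightarrow> real) \<Rightarrow> 'a \<Rightarrow> 'a slot \<Rightarrow> real"
  where "slot_point \<sigma> x s = (case s of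
      Shared A l \<Rightarrow> if x \<in> A then weight (\<sigma> A) l else 0
    | Private y z l \<Rightarrow> if x = y then 1 - weight (\<sigma> {y, z}) l else 0
    | Own y r \<Rightarrow> if x = y then 1 else 0)"

definition slots :: "'a set \<Rightarrow> nat \<Rightarrow> nat \<Rightarrow> 'a slot set"
  where "slots X L C =
    (\<lambda>(A, l). Shared A l) ` ({A. A \<subseteq> X \<and> card A = 2} \<times> {..<L}) \<union>
    (\<lambda>(y, z, l). Private y z l) ` ({(y, z, l). y \<in> X \<and> z \<in> X \<and> y \<noteq> z \<and> l < L}) \<union>
    (\<lambda>(y, r). Own y r) ` (X \<times> {..<C})"

lemma in_slots [simp]:
  "Shared A l \<in> slots X L C \<longleftrightarrow> A \<subseteq> X \<and> card A = 2 \<and> l < L"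
  "Private y z l \<in> slots X L C \<longleftrightarrow> y \<in> X \<and> z \<in> X \<and> y \<noteq> z \<and> l < L"
  "Own y r \<in> slots X L C \<longleftrightarrow> y \<in> X \<and> r < C"
  by (auto simp: slots_def image_iff)

lemma finite_slots: "finite X \<Longrightarrow> finite (slots X L C)"
  unfolding slots_def
  by (intro finite_UnI finite_imageI finite_cartesian_product
      finite_subset[of "{(y, z, l). y \<in> X \<and> z \<in> X \<and> y \<noteq> z \<and> l < L}" "X \<times> X \<times> {..<L}"]) auto

lemma slot_point_bounds: "0 \<le> slot_point \<sigma> x s" "slot_point \<sigma> x s \<le> 1"
  using weight_bounds by (cases s; auto simp: slot_point_def)+

lemma abs_slot_point_diff_le: "\<bar>slot_point \<sigma> x s - slot_point \<sigma> y s\<bar> \<le> 1"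
  using slot_point_bounds[of \<sigma> x s] slot_point_bounds[of \<sigma> y s] by linarith

section \<open>Slots in which two points differ\<close>

context
  fixes X :: "'a set" and x y :: 'a and \<sigma> :: "'a set \<Rightarrow> real" and L C :: nat
  assumes X: "finite X" and xy: "x \<in> X" "y \<in> X" "x \<noteq> y"
begin

text \<open>These are the pairs that meet \<open>{x, y}\<close> in exactly one point, with that
  point listed first.\<close>

private definition T where "T = {x, y} \<times> (X - {x, y})"

text \<open>Unless \<open>l\<close> is the floor of \<open>\<sigma> {c, z}\<close>, this slot holds
  unit \<open>l\<close> of \<open>c\<close> in full; at the floor the unit may be split between
  \<open>Shared\<close> and \<open>Private\<close>.\<close>

private definition g where
  "g = (\<lambda>((c, z), l). if l < nat \<lfloor>\<sigma> {c, z}\<rfloor> then Shared {c, z} l else Private c z l)"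

private lemma finite_T: "finite T" and card_T: "card T = 2 * (card X - 2)"
  using X xy by (simp_all add: T_def card_cartesian_product)

private lemma T_cases:
  assumes "A \<subseteq> X" "card A = 2" "c \<in> A" "c' \<notin> A" "{c, c'} = {x, y}"
  obtains z where "A = {c, z}" "(c, z) \<in> T"
proof -
  obtain z where "A = {c, z}" "c \<noteq> z"
    using assms(2,3) by (auto simp: card_2_iff doubleton_eq_iff)
  moreover from this have "z \<in> X - {x, y}" using assms by auto
  moreover have "c \<in> {x, y}" using assms(5) by blast
  ultimately show thesis using that by (simp add: T_def)
qed

text \<open>The units of the pair \<open>{x, y}\<close> are all shared and cancel. Each member of
  \<open>T\<close> adds at most \<open>L + 1\<close> slots, because at most one of its
  \<open>L\<close> units is split over two.\<close>

lemma card_support_le: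
  assumes full: "real L \<le> \<sigma> {x, y}"
  shows "card {s \<in> slots X L C. slot_point \<sigma> x s - slot_point \<sigma> y s \<noteq> 0}
    \<le> 2 * (card X - 2) * (L + 1) + 2 * C"
proof -
  \<comment> \<open>The middle part consists of the \<open>Shared\<close> halves of the split units;
    \<open>g\<close> yields the \<open>Private\<close> halves.\<close>
  define U where "U = g ` (T \<times> {..<L}) \<union> (\<lambda>(c, z). Shared {c, z} (nat \<lfloor>\<sigma> {c, z}\<rfloor>)) ` T
    \<union> (\<lambda>(c, r). Own c r) ` ({x, y} \<times> {..<C})"
  have gU: "g ((c, z), l) \<in> U" if "(c, z) \<in> T" "l < L" for c z l
    using that unfolding U_def by blast
  have hU: "Shared {c, z} (nat \<lfloor>\<sigma> {c, z}\<rfloor>) \<in> U" if "(c, z) \<in> T" for c z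
    unfolding U_def using that by (intro UnI1 UnI2) (auto intro!: image_eqI[of _ _ "(c, z)"])
  have shared: "Shared A l \<in> U"
    if A: "A \<subseteq> X" "card A = 2" "l < L" "weight (\<sigma> A) l \<noteq> 0" "c \<in> A" "c' \<notin> A" "{c, c'} = {x, y}"
    for A l c c'
  proof -
    obtain z where z: "A = {c, z}" "(c, z) \<in> T" using T_cases A by metis
    have "l \<le> nat \<lfloor>\<sigma> A\<rfloor>" using weight_eq_0[of "\<sigma> A" l] A(4) by force
    then consider "l < nat \<lfloor>\<sigma> A\<rfloor>" | "l = nat \<lfloor>\<sigma> A\<rfloor>" by linarith
    then show ?thesis
    proof cases
      case 1
      then show ?thesis using gU[OF z(2) A(3)] by (simp add: g_def z(1))
    next
      case 2
      then show ?thesis using hU[OF z(2)] by (simp add: z(1))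
    qed
  qed
  have unshared: "Private c z l \<in> U"
    if A: "z \<in> X" "c \<noteq> z" "l < L" "weight (\<sigma> {c, z}) l \<noteq> 1" "c \<in> {x, y}" for c z l
  proof -
    have "weight (\<sigma> {x, y}) l = 1" using full A(3) by (auto simp: weight_def)
    then have "{c, z} \<noteq> {x, y}" using A(4) by metis
    then have "(c, z) \<in> T" using A by (auto simp: T_def)
    moreover have "\<not> l < nat \<lfloor>\<sigma> {c, z}\<rfloor>" using weight_eq_1 A(4) by blast
    ultimately show ?thesis using gU[of c z l] A(3) by (simp add: g_def)
  qed
  have "s \<in> U" if s: "s \<in> slots X L C" "slot_point \<sigma> x s - slot_point \<sigma> y s \<noteq> 0" for s
  proof (cases s)
    case (Shared A l)
    have A: "A \<subseteq> X" "card A = 2" "l < L" using s(1) Shared by simp_all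
    have "weight (\<sigma> A) l \<noteq> 0" using s(2) Shared by (auto simp: slot_point_def split: if_splits)
    moreover have "x \<in> A \<and> y \<notin> A \<or> y \<in> A \<and> x \<notin> A"
      using s(2) Shared by (auto simp: slot_point_def split: if_splits)
    ultimately show ?thesis
      unfolding Shared using shared[OF A, of x y] shared[OF A, of y x] by blast
  next
    case (Private c z l)
    have "z \<in> X" "c \<noteq> z" "l < L" using s(1) Private by auto
    moreover have "weight (\<sigma> {c, z}) l \<noteq> 1" "c \<in> {x, y}"
      using s(2) Private by (auto simp: slot_point_def split: if_splits)
    ultimately show ?thesis unfolding Private by (rule unshared)
  next
    case (Own c r)
    then have "c \<in> {x, y}" "r < C" using s by (auto simp: slot_point_def split: if_splits)
    then show ?thesis unfolding U_def Own by (intro UnI2 image_eqI[of _ _ "(c, r)"]) auto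
  qed
  moreover have "finite U" unfolding U_def using finite_T by simp
  ultimately have "card {s \<in> slots X L C. slot_point \<sigma> x s - slot_point \<sigma> y s \<noteq> 0} \<le> card U"
    by (intro card_mono) auto
  also have "\<dots> \<le> card (T \<times> {..<L}) + card T + card ({x, y} \<times> {..<C})"
    unfolding U_def
    by (intro order_trans[OF card_Un_le] add_mono card_image_le) (use finite_T in auto)
  also have "\<dots> = 2 * (card X - 2) * (L + 1) + 2 * C"
    using xy unfolding card_cartesian_product card_T by (simp add: distrib_left)
  finally show ?thesis .
qed

text \<open>Nothing is shared by \<open>x\<close> and \<open>y\<close>, so the \<open>2 * L\<close>
  private units of their pair count in full. Each member of \<open>T\<close> has at least
  \<open>L - 1\<close> unsplit units; the one that may be split is left out.\<close>

lemma exists_unit_slots: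
  assumes empty: "\<sigma> {x, y} \<le> 0"
  shows "\<exists>A \<subseteq> slots X L C. (\<forall>s\<in>A. 1 \<le> \<bar>slot_point \<sigma> x s - slot_point \<sigma> y s\<bar>) \<and>
    2 * (card X - 2) * (L - 1) + 2 * L + 2 * C \<le> card A"
proof -
  define T' where "T' = (SIGMA q:T. {..<L} - {nat \<lfloor>\<sigma> {fst q, snd q}\<rfloor>})"
  define E where "E = (\<lambda>(c, r). Own c r) ` ({x, y} \<times> {..<C})"
  define F where "F = Private x y ` {..<L} \<union> Private y x ` {..<L}"
  have fin: "finite T'" "finite E" "finite F"
    using finite_T by (simp_all add: T'_def E_def F_def)
  have "card T' = (\<Sum>q\<in>T. card ({..<L} - {nat \<lfloor>\<sigma> {fst q, snd q}\<rfloor>}))"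
    unfolding T'_def using finite_T by (intro card_SigmaI) auto
  also have "\<dots> \<ge> (\<Sum>q\<in>T. L - 1)"
    by (intro sum_mono) (simp add: card_Diff_singleton_if)
  finally have cT': "2 * (card X - 2) * (L - 1) \<le> card T'" by (simp add: card_T)
  have "inj_on g T'"
    using xy by (auto simp: inj_on_def g_def T'_def T_def doubleton_eq_iff split: if_splits)
  then have cg: "card (g ` T') = card T'" by (rule card_image)
  have cE: "card E = 2 * C"
    unfolding E_def using xy by (subst card_image) (auto simp: inj_on_def card_cartesian_product)
  have cF: "card F = 2 * L"
    unfolding F_def using xy by (subst card_Un_disjoint) (auto simp: card_image inj_on_def)
  have "g ` T' \<inter> E = {}" "(g ` T' \<union> E) \<inter> F = {}"
    using xy by (auto simp: g_def T'_def T_def E_def F_def split: if_splits)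
  then have "card (g ` T' \<union> E \<union> F) = card T' + 2 * C + 2 * L"
    using fin by (simp add: card_Un_disjoint cg cE cF)
  moreover have "g ` T' \<union> E \<union> F \<subseteq> slots X L C"
    using xy by (auto simp: g_def T'_def T_def E_def F_def card_insert_if split: if_splits)
  moreover have "1 \<le> \<bar>slot_point \<sigma> x s - slot_point \<sigma> y s\<bar>" if "s \<in> g ` T' \<union> E \<union> F" for s
  proof -
    have "weight (\<sigma> {x, y}) l = 0" for l using empty by (simp add: weight_def)
    then have "1 \<le> \<bar>slot_point \<sigma> x s - slot_point \<sigma> y s\<bar>" if "s \<in> E \<union> F"
      using that xy by (auto simp: E_def F_def slot_point_def insert_commute)
    moreover have "1 \<le> \<bar>slot_point \<sigma> x s - slot_point \<sigma> y s\<bar>" if "s \<in> g ` T'"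
    proof -
      obtain c z l where s: "s = g ((c, z), l)" and cz: "(c, z) \<in> T" and l: "l \<noteq> nat \<lfloor>\<sigma> {c, z}\<rfloor>"
        using \<open>s \<in> g ` T'\<close> unfolding T'_def by fastforce
      show ?thesis
      proof (cases "l < nat \<lfloor>\<sigma> {c, z}\<rfloor>")
        case True
        then show ?thesis
          using weight_eq_1[OF True] cz xy by (auto simp: s g_def slot_point_def T_def)
      next
        case False
        then have "weight (\<sigma> {c, z}) l = 0" using l by (intro weight_eq_0) simp
        then show ?thesis
          using False cz xy by (auto simp: s g_def slot_point_def T_def)
      qed
    qed
    ultimately show ?thesis using \<open>s \<in> g ` T' \<union> E \<union> F\<close> by blast
  qed
  ultimately show ?thesis using cT' by (intro exI[of _ "g ` T' \<union> E \<union> F"]) auto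
qed

end

text \<open>The parameter of a pair changes its symmetric difference by \<open>2 * L\<close> slots.
  The other parameters only move units of a point between \<open>Shared\<close> and
  \<open>Private\<close> slots, which affects the count through split units alone.\<close>

lemma near_equilateral_embeds_unbounded:
  fixes X :: "'a set"
  assumes P: "sign_list_norm P" and rep: "fin_rep TYPE('b::real_normed_vector) P"
    and unbounded: "\<And>K. \<exists>m. K < P (replicate m 1)" and X: "finite X"
  shows "near_equilateral_embeds TYPE('b) X"
proof -
  interpret sign_list_norm P by fact
  define \<phi> where "\<phi> m = P (replicate m 1)" for m
  \<comment> \<open>Splitting makes the count uncertain by 2 for each of the
    \<open>2 * (card X - 2)\<close> members of \<open>T\<close>; this \<open>L\<close> lets
    \<open>2 * L\<close> outweigh the total by at least 2.\<close>
  define L where "L = 2 * card X + 2"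
  define a where "a = 2 * (card X - 2) * (L + 1)"
  define b where "b = 2 * (card X - 2) * (L - 1) + 2 * L"
  have ab: "a + 2 \<le> b"
  proof -
    have "2 * (card X - 2) * (L + 1) = 2 * (card X - 2) * (L - 1) + 4 * (card X - 2)"
    proof -
      have "L + 1 = L - 1 + 2" by (simp add: L_def)
      then show ?thesis by (simp only: distrib_left)
    qed
    then show ?thesis by (simp add: a_def b_def L_def)
  qed
  \<comment> \<open>If no padding \<open>C\<close> separated the two values, then
    \<open>a + 2 * Suc C \<le> b + 2 * C\<close> and monotonicity would keep \<open>\<phi>\<close>
    below \<open>\<phi> a\<close> along all \<open>a + 2 * C\<close>, against unboundedness.\<close>
  have "\<exists>C. \<phi> (a + 2 * C) < \<phi> (b + 2 * C)"
  proof (rule ccontr)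
    assume "\<not> ?thesis"
    then have le: "\<phi> (b + 2 * C) \<le> \<phi> (a + 2 * C)" for C by (simp add: not_less)
    have "\<phi> (a + 2 * C) \<le> \<phi> a" for C
    proof (induction C)
      case (Suc C)
      have "\<phi> (a + 2 * Suc C) \<le> \<phi> (b + 2 * C)" using ab unfolding \<phi>_def by (intro mono_replicate) simp
      with le[of C] Suc show ?case by simp
    qed simp
    moreover obtain m where "\<phi> a < \<phi> m" using unbounded \<phi>_def by auto
    moreover have "\<phi> m \<le> \<phi> (a + 2 * m)" unfolding \<phi>_def by (intro mono_replicate) simp
    ultimately show False by (meson not_less order_trans)
  qed
  then obtain C where C: "\<phi> (a + 2 * C) < \<phi> (b + 2 * C)" by blast
  obtain sl where sl: "set sl = slots X L C" "distinct sl"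
    using finite_distinct_list[OF finite_slots[OF X]] by blast
  \<comment> \<open>At parameter 0 the pair shares all its units and is close; at 1 it shares none
    and is far apart.\<close>
  define \<sigma> :: "('a set \<Rightarrow> real) \<Rightarrow> 'a set \<Rightarrow> real" where "\<sigma> t A = real L * (1 - t A)" for t A
  show ?thesis
  proof (rule near_equilateral_embedsI[where v = "\<lambda>t. slot_point (\<sigma> t)" and sl = sl
        and lo = "\<phi> (a + 2 * C)" and hi = "\<phi> (b + 2 * C)" and B = 1])
    show "list_norm P" ..
    show "continuous_on {t. \<forall>A. 0 \<le> t A \<and> t A \<le> 1} (\<lambda>t. slot_point (\<sigma> t) x s)" for x s
    proof -
      have "continuous_on {t. \<forall>A. 0 \<le> t A \<and> t A \<le> 1} (\<lambda>t. weight (\<sigma> t A) l)" for A l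
        unfolding weight_def \<sigma>_def by (intro continuous_intros continuous_on_coordinate)
      note weight = this
      show ?thesis
      proof (cases s)
        case (Shared A l)
        then show ?thesis by (cases "x \<in> A") (simp_all add: slot_point_def weight)
      next
        case (Private y z l)
        then show ?thesis by (cases "x = y") (simp_all add: slot_point_def weight continuous_on_diff)
      qed (simp add: slot_point_def)
    qed
    show "\<bar>slot_point (\<sigma> t) x s\<bar> \<le> 1" for t x s
      using slot_point_bounds[of "\<sigma> t" x s] by simp
    fix t :: "'a set \<Rightarrow> real" and x y assume xy: "x \<in> X" "y \<in> X" "x \<noteq> y"
    show "P (map (\<lambda>s. slot_point (\<sigma> t) x s - slot_point (\<sigma> t) y s) sl) \<le> \<phi> (a + 2 * C)"
      if "t {x, y} = 0"
      unfolding \<phi>_def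
    proof (rule map_le_replicate[OF sl(2) abs_slot_point_diff_le])
      show "card {s \<in> set sl. slot_point (\<sigma> t) x s - slot_point (\<sigma> t) y s \<noteq> 0} \<le> a + 2 * C"
        unfolding sl(1) a_def by (rule card_support_le[OF X xy]) (simp add: \<sigma>_def that)
    qed
    show "\<phi> (b + 2 * C) \<le> P (map (\<lambda>s. slot_point (\<sigma> t) x s - slot_point (\<sigma> t) y s) sl)"
      if "t {x, y} = 1"
    proof -
      have "\<sigma> t {x, y} \<le> 0" by (simp add: \<sigma>_def that)
      from exists_unit_slots[OF X xy, of "\<sigma> t" L C, OF this] obtain A
        where A: "A \<subseteq> slots X L C" "\<forall>s\<in>A. 1 \<le> \<bar>slot_point (\<sigma> t) x s - slot_point (\<sigma> t) y s\<bar>"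
          "b + 2 * C \<le> card A"
        unfolding b_def by blast
      show ?thesis unfolding \<phi>_def
        by (rule replicate_le_map[OF sl(2) _ _ A(3)]) (use A(1,2) sl(1) in auto)
    qed
  qed (use rep X C nonneg in \<open>auto simp: \<phi>_def\<close>)
qed

section \<open>Sign invariance in the limit\<close>

lemma block_block: "block v (block w c) = block (block v w) c"
  by (induction c) (simp_all add: block_scale)

text \<open>An alternating word \<open>z @ [- c]\<close> becomes \<open>- c # z\<close> when all
  signs change: a single entry moves from one end to the other. Taking it out and putting it back
  cost \<open>\<bar>c\<bar> * P [1]\<close> each, whatever \<open>m\<close> is.\<close>

lemma alternating_block_flip:
  assumes P: "list_norm P" and m: "0 < m"
  shows "P (A @ block (block [1, - 1] (replicate m 1)) [- c] @ B)
    \<le> P (A @ block (block [1, - 1] (replicate m 1)) [c] @ B) + 2 * \<bar>c\<bar> * P [1]"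
proof -
  interpret list_norm P by fact
  have shift: "P (A @ c # z @ B) \<le> P (A @ z @ c # B) + 2 * \<bar>c\<bar> * P [1]" for c z
  proof -
    have remove: "P (U @ V) \<le> P (U @ c # V) + \<bar>c\<bar> * P [1]"
      and insert: "P (U @ c # V) \<le> P (U @ V) + \<bar>c\<bar> * P [1]" for U V
    proof -
      define e where "e = replicate (length U) 0 @ c # replicate (length V) 0"
      have "P e = P [c]"
        using insert_zeros[of "[]" "length U" "c # replicate (length V) 0"]
          insert_zeros[of "[c]" "length V" "[]"] by (simp add: e_def)
      then have e: "P e = \<bar>c\<bar> * P [1]" using single[of c] by simp
      have "U @ c # V = map2 (+) (U @ 0 # V) e" by (simp add: e_def zip_replicate2 o_def)
      then show "P (U @ c # V) \<le> P (U @ V) + \<bar>c\<bar> * P [1]"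
        using add_le[of "U @ 0 # V" e] e by (simp add: insert_zero e_def)
      have "U @ 0 # V = map2 (+) (U @ c # V) (map ((*) (- 1)) e)"
        by (simp add: e_def zip_replicate2 o_def)
      then show "P (U @ V) \<le> P (U @ c # V) + \<bar>c\<bar> * P [1]"
        using add_le[of "U @ c # V" "map ((*) (- 1)) e"] scale[of "- 1" e] e
        by (simp add: insert_zero e_def)
    qed
    have "P (A @ c # z @ B) \<le> P (A @ z @ B) + \<bar>c\<bar> * P [1]" by (rule insert)
    also have "P (A @ z @ B) \<le> P ((A @ z) @ c # B) + \<bar>c\<bar> * P [1]" using remove[of "A @ z" B] by simp
    finally show ?thesis by simp
  qed
  have alt: "\<exists>z. block (block [1, - 1] (replicate m 1)) [c] = z @ [- c] \<and>
      block (block [1, - 1] (replicate m 1)) [- c] = - c # z" for c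
    using m
  proof (induction m)
    case (Suc m)
    show ?case
    proof (cases "m = 0")
      case False
      then obtain z where "block (block [1, - 1] (replicate m 1)) [c] = z @ [- c]"
        "block (block [1, - 1] (replicate m 1)) [- c] = - c # z" using Suc by blast
      then show ?thesis by (intro exI[of _ "c # - c # z"]) simp
    qed simp
  qed simp
  then obtain z where "block (block [1, - 1] (replicate m 1)) [c] = z @ [- c]"
    "block (block [1, - 1] (replicate m 1)) [- c] = - c # z" by blast
  then show ?thesis using shift[of "- c" z] by simp
qed

lemma near_equilateral_embeds_infinite_dimensional:
  fixes X :: "'a set"
  assumes "infinite_dimensional TYPE('b::real_normed_vector)" and X: "finite X"
  shows "near_equilateral_embeds TYPE('b) X"
proof -
  obtain U :: "nat filter" where U: "ultra U" "U \<le> sequentially"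
    using exists_ultra_le[of sequentially] by auto
  then have U_bot: "U \<noteq> bot" by (simp add: ultra_def)
  obtain x :: "nat \<Rightarrow> 'b" where x: "\<And>k. norm (x k) \<le> 1" "\<And>k l. k < l \<Longrightarrow> 1 / 2 \<le> norm (x k - x l)"
    using separated_sequence[OF assms(1)] by blast
  define N where "N c = iterated_lim U x c 0" for c
  have N: "list_norm N" "fin_rep TYPE('b) N"
    unfolding N_def by (rule list_norm_iterated_lim[OF U(1) x(1)] fin_rep_iterated_lim[OF U(1) x(1)])+
  interpret N: list_norm N by (rule N(1))
  define M where "M c = N (block [1, - 1] c)" for c
  have M: "list_norm M" "fin_rep TYPE('b) M"
    unfolding M_def by (rule list_norm_block[OF N(1)] fin_rep_block[OF N(2)])+
  interpret M: list_norm M by (rule M(1))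
  have drop: "M (a @ b) \<le> M (a @ c # b)" for a b c
    using N.remove_difference[of "block [1, - 1] a" "block [1, - 1] b" c] by (simp add: M_def)
  have "1 / 2 \<le> N [1, - 1]"
    unfolding N_def by (rule iterated_lim_difference[OF U(1) x(1) U(2) x(2)])
  then have M1: "0 < M [1]" by (simp add: M_def)
  define \<phi> where "\<phi> m = M (replicate m 1)" for m
  have inc: "incseq \<phi>"
    unfolding \<phi>_def using drop[of "[]"] by (intro incseq_SucI) simp
  show ?thesis
  proof (cases "\<exists>C. \<forall>m. \<phi> m \<le> C")
    case True
    then obtain C where "\<And>m. M (replicate m 1) \<le> C" by (auto simp: \<phi>_def)
    then show ?thesis by (rule near_equilateral_embeds_bounded[OF M drop M1 _ X])
  next
    case False
    have \<phi>_pos: "0 < \<phi> (Suc h)" for h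
      using incseqD[OF inc, of 1 "Suc h"] M1 by (simp add: \<phi>_def)
    have \<phi>_lim: "filterlim (\<lambda>h. \<phi> (Suc h)) at_top U"
    proof -
      have "filterlim \<phi> at_top sequentially"
        unfolding filterlim_at_top eventually_sequentially
        using False incseqD[OF inc] by (meson linear order_trans)
      then have "filterlim (\<lambda>h. \<phi> (Suc h)) at_top sequentially"
        using filterlim_compose filterlim_Suc by blast
      then show ?thesis using U(2) filterlim_mono by blast
    qed
    \<comment> \<open>The successor keeps the divisor positive, as
      \<open>\<phi> 0 = 0\<close>.\<close>
    define Q where "Q h c = 1 / \<phi> (Suc h) * M (block (replicate (Suc h) 1) c)" for h c
    have Q: "list_norm (Q h)" "fin_rep TYPE('b) (Q h)" for h
      unfolding Q_def using \<phi>_pos[of h]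
      by (intro list_norm_scale fin_rep_scale list_norm_block fin_rep_block M; simp)+
    have Q1: "Q h [1] = 1" for h
      using \<phi>_pos[of h] by (simp add: Q_def \<phi>_def map_replicate)
    have "Q h c \<le> (\<Sum>a\<leftarrow>c. \<bar>a\<bar>)" for h c
      using list_norm.le_sum_abs[OF Q(1), of h c] by (simp add: Q1)
    note lim = list_norm_Lim[OF U(1) Q(1) this]
    define R where "R c = Lim U (\<lambda>h. Q h c)" for c
    have R: "list_norm R" "\<And>c. ((\<lambda>h. Q h c) \<longlongrightarrow> R c) U" "fin_rep TYPE('b) R"
      unfolding R_def by (rule lim fin_rep_tendsto[OF Q(2) U_bot])+
    \<comment> \<open>In terms of \<open>N\<close> the blocks are alternating words, so a flip costs
      a constant; division by \<open>\<phi> (Suc h)\<close>, which tends to infinity, removes it in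
      the limit.\<close>
    have flip_le: "R (a @ - c # b) \<le> R (a @ c # b)" for a c b
    proof -
      have "Q h (a @ - c # b) \<le> Q h (a @ c # b) + 2 * \<bar>c\<bar> * N [1] / \<phi> (Suc h)" for h
      proof -
        let ?w = "block [1, - 1] (replicate (Suc h) 1)"
        have "N (block ?w (a @ - c # b)) \<le> N (block ?w (a @ c # b)) + 2 * \<bar>c\<bar> * N [1]"
          using alternating_block_flip[OF N(1), of "Suc h" "block ?w a" c "block ?w b"]
          by (simp del: replicate_Suc)
        then show ?thesis
          using \<phi>_pos[of h] unfolding Q_def M_def block_block by (simp add: field_simps)
      qed
      moreover have "((\<lambda>h. Q h (a @ c # b) + 2 * \<bar>c\<bar> * N [1] / \<phi> (Suc h)) \<longlongrightarrow> R (a @ c # b) + 0) U"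
        by (intro tendsto_add R(2) tendsto_divide_0[OF tendsto_const]
            filterlim_at_top_imp_at_infinity \<phi>_lim)
      ultimately have "R (a @ - c # b) \<le> R (a @ c # b) + 0"
        by (intro tendsto_le[OF U_bot _ R(2)] always_eventually allI)
      then show ?thesis by simp
    qed
    interpret R: list_norm R by (rule R(1))
    interpret R: sign_list_norm R
    proof
      show "R (a @ - c # b) = R (a @ c # b)" for a c b
        using flip_le[of a c b] flip_le[of a "- c" b] by simp
    qed
    show ?thesis
    proof (cases "\<exists>C. \<forall>m. R (replicate m 1) \<le> C")
      case True
      then obtain C where C: "\<And>m. R (replicate m 1) \<le> C" by blast
      have "R [1] = 1" unfolding R_def Q1 using U_bot by (simp add: tendsto_Lim)
      then show ?thesis
        using near_equilateral_embeds_bounded[OF R(1,3) R.drop_entry _ C X] by simp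
    next
      case False
      then show ?thesis
        by (intro near_equilateral_embeds_unbounded[OF R.sign_list_norm_axioms R(3) _ X])
          (meson not_le)
    qed
  qed
qed

section \<open>Snowflakes with small exponents\<close>

theorem theorem5p1:
  fixes X :: "'a set" and d :: "'a \<Rightarrow> 'a \<Rightarrow> real"
  assumes "Metric_space X d"
    and "finite X"
    and "infinite_dimensional TYPE('b::banach)"
  shows "\<exists>\<alpha>'::real. 0 < \<alpha>' \<and> \<alpha>' < 1 \<and>
           (\<forall>\<alpha>. 0 < \<alpha> \<and> \<alpha> < \<alpha>' \<longrightarrow>
             (\<exists>f :: 'a \<Rightarrow> 'b. isometric_embedding X (snowflake \<alpha> d) f))"
proof -
  interpret Metric_space X d by fact
  obtain r1 r2 where r: "0 < r1" "r1 < r2" and emb: "\<And>\<rho>.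
      \<forall>x\<in>X. \<forall>y\<in>X. x \<noteq> y \<longrightarrow> \<rho> x y = \<rho> y x \<and> r1 \<le> \<rho> x y \<and> \<rho> x y \<le> r2 \<Longrightarrow>
      \<exists>f :: 'a \<Rightarrow> 'b. \<forall>x\<in>X. \<forall>y\<in>X. x \<noteq> y \<longrightarrow> dist (f x) (f y) = \<rho> x y"
    using near_equilateral_embeds_infinite_dimensional[OF assms(3,2)]
    unfolding near_equilateral_embeds_def by blast
  \<comment> \<open>As \<open>\<alpha>\<close> tends to 0, \<open>c * d x y powr \<alpha>\<close>
    tends to \<open>c\<close>, which is interior to the admissible interval. The factor is divided
    out of the embedding at the end.\<close>
  define c where "c = (r1 + r2) / 2"
  have c: "0 < c" "r1 < c" "c < r2" using r by (auto simp: c_def)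
  have ev: "eventually (\<lambda>\<alpha>. r1 \<le> c * d x y powr \<alpha> \<and> c * d x y powr \<alpha> \<le> r2) (at_right 0)"
    if "x \<in> X" "y \<in> X" "x \<noteq> y" for x y
  proof -
    have "0 < d x y" using that by simp
    then have "((\<lambda>\<alpha>. c * d x y powr \<alpha>) \<longlongrightarrow> c * d x y powr 0) (at_right 0)"
      by (intro tendsto_intros) auto
    then have lim: "((\<lambda>\<alpha>. c * d x y powr \<alpha>) \<longlongrightarrow> c) (at_right 0)" using \<open>0 < d x y\<close> by simp
    show ?thesis
      using order_tendstoD(1)[OF lim c(2)] order_tendstoD(2)[OF lim c(3)]
      by eventually_elim simp
  qed
  define K where "K \<alpha> \<longleftrightarrow> (\<forall>x\<in>X. \<forall>y\<in>X. x \<noteq> y \<longrightarrow>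
    r1 \<le> c * d x y powr \<alpha> \<and> c * d x y powr \<alpha> \<le> r2)" for \<alpha>
  have "eventually K (at_right 0)"
    unfolding K_def
  proof (intro eventually_ball_finite ballI assms(2))
    show "eventually (\<lambda>\<alpha>. x \<noteq> y \<longrightarrow> r1 \<le> c * d x y powr \<alpha> \<and> c * d x y powr \<alpha> \<le> r2) (at_right 0)"
      if "x \<in> X" "y \<in> X" for x y
      by (cases "x = y") (use ev[OF that] in simp_all)
  qed
  then obtain b where b: "0 < b" and K: "\<And>\<alpha>. 0 < \<alpha> \<Longrightarrow> \<alpha> < b \<Longrightarrow> K \<alpha>"
    by (auto simp: eventually_at_right_field)
  have "\<exists>f :: 'a \<Rightarrow> 'b. isometric_embedding X (snowflake \<alpha> d) f" if \<alpha>: "0 < \<alpha>" "\<alpha> < b" for \<alpha>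
  proof -
    have "\<forall>x\<in>X. \<forall>y\<in>X. x \<noteq> y \<longrightarrow> c * d x y powr \<alpha> = c * d y x powr \<alpha> \<and>
        r1 \<le> c * d x y powr \<alpha> \<and> c * d x y powr \<alpha> \<le> r2"
    proof (intro ballI impI)
      fix x y assume xy: "x \<in> X" "y \<in> X" "x \<noteq> y"
      have "d x y = d y x" by (rule commute)
      then show "c * d x y powr \<alpha> = c * d y x powr \<alpha> \<and>
          r1 \<le> c * d x y powr \<alpha> \<and> c * d x y powr \<alpha> \<le> r2"
        using K[OF \<alpha>, unfolded K_def, rule_format, OF xy] by metis
    qed
    from emb[OF this] obtain f :: "'a \<Rightarrow> 'b"
      where f: "\<forall>x\<in>X. \<forall>y\<in>X. x \<noteq> y \<longrightarrow> dist (f x) (f y) = c * d x y powr \<alpha>"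
      by blast
    have "dist ((1 / c) *\<^sub>R f x) ((1 / c) *\<^sub>R f y) = snowflake \<alpha> d x y" if "x \<in> X" "y \<in> X" for x y
    proof (cases "x = y")
      case False
      have "dist ((1 / c) *\<^sub>R f x) ((1 / c) *\<^sub>R f y) = 1 / c * dist (f x) (f y)"
        using c by (simp add: dist_norm flip: scaleR_diff_right)
      then show ?thesis using f that False c by (simp add: snowflake_def)
    qed (use that in \<open>simp add: snowflake_def\<close>)
    then show ?thesis
      unfolding isometric_embedding_def by (intro exI[of _ "\<lambda>x. (1 / c) *\<^sub>R f x"]) simp
  qed
  then show ?thesis using b by (intro exI[of _ "min b (1 / 2)"]) auto
qed

end
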